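(* Let $\Xi\subset\mathbb R^r$ and let $f:\mathbb R^n\times\Xi\to\mathbb R$ and $g:\mathbb R^n\times\Xi\to\mathbb R^m$ be twice continuously differentiable in $(x,\xi)$. Consider the parametrized problem $\min_x f(x,\xi)$ subject to $g(x,\xi)\le0$, with feasible set $\mathcal X(\xi)=\{x: g(x,\xi)\le0\}$, and assume: (1) $\mathcal X(\xi)\neq\emptyset$ for all $\xi\in\Xi$; (2) for all $\xi\in\Xi$, $f(\cdot,\xi)$ is $\alpha$-strongly convex and has a $\beta$-Lipschitz gradient $\nabla_xf$ in $x$; and for all $i=1,\dots,m$ and all $\xi\in\Xi$, $g_i(\cdot,\xi)$ is convex and $\nabla_xg_i$ is $\ell_i$-Lipschitz in $x$; (3) there exists $\omega>0$ such that for all $\xi\in\Xi$ and all $x\in\mathcal X(\xi)$ with $\mathbf I^\xi_x\ne\emptyset$, $\ \omega^2\mathbb I\preceq\nabla_xg_{\mathbf I^\xi_x}(x,\xi)\nabla_xg_{\mathbf I^\xi_x}(x,\xi)^\top$; (4) there exist $\zeta_i>0$ such that for all $\xi\in\Xi$ and every KKT point $(x^\star(\xi),\mu^\star(\xi))$ one has $\mu_i^\star(\xi)\le\zeta_i$ for all $i=1,\dots,m$. Then the primal and dual solution maps $x^\star:\Xi\to\mathbb R^n$ and $\mu^\star:\Xi\to\mathbb R^m$ are single-valued and Lipschitz continuous on $\Xi$ with respective Lipschitz constants $$\ell_{x^\star}:=\sqrt{\frac{\beta+\sum_i\zeta_i\ell_i}{\alpha}}\left(\frac{\bar L^\star}{\alpha}+\frac{\bar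 G^\star}{\omega}\right),\qquad \ell_{\mu^\star}:=\frac{(\beta+\sum_i\zeta_i\ell_i)^{3/2}}{\alpha^{1/2}\omega}\left(\frac{\bar L^\star}{\alpha}+\frac{\bar G^\star}{\omega}\right),$$ where $\bar L^\star:=\sup_{\xi\in\Xi}\|L^\star(\xi)\|$ and $\bar G^\star:=\sup_{\xi\in\Xi}\|G^\star(\xi)\|$.
   Context: $\mathbf I^\xi_x=\{i: g_i(x,\xi)=0\}$ is the active set at $x\in\mathcal X(\xi)$, and $g_{\mathbf I}$ denotes the components of $g$ with indices in $\mathbf I$; $\nabla_x g_{\mathbf I}$ is its Jacobian. The Lagrangian is $L(x,\mu,\xi)=f(x,\xi)+\mu^\top g(x,\xi)$. A KKT point for $\xi$ is $(x,\mu)\in\mathcal X(\xi)\times\mathbb R^m_{\ge0}$ with $\nabla_xL(x,\mu,\xi)=0$ and $\mu_i=0$ whenever $g_i(x,\xi)<0$. The primal solution map $x^\star$ assigns to $\xi$ the optimizer, and the dual solution map $\mu^\star$ assigns to $\xi$ the corresponding KKT multiplier. $L^\star(\xi)=\nabla^2_{\xi x}L(x^\star(\xi),\mu^\star(\xi),\xi)\in\mathbb R^{n\times r}$ is the Jacobian with respect to $\xi$ of the column gradient of $L$ with respect to $x$ (with $x,\mu$ held fixed in the differentiation in $\xi$), and $G^\star(\xi)=\nabla_\xi g_{\mathbf I^\star(\xi)}(x^\star(\xi),\xi)$ with $\mathbf I^\star(\xi)=\mathbf I^\xi_{x^\star(\xi)}$ (convention: $G^\star(\xi)=0$ if $\mathbf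 I^\star(\xi)=\emptyset$). $\|\cdot\|$ is the Euclidean norm or induced operator norm. $A\preceq B$ means $B-A$ is positive semidefinite, and $\mathbb I$ is the identity matrix.
   Formalization: Ξ is assumed convex and nonempty, with finite suprema L̄* and Ḡ*; f and g are C² near ℝⁿ×Ξ. For disconnected Ξ the claim fails: Ξ=(0,1)∪(2,3), f=(x−h(ξ))²/2 with h=0 then 1, g=x−5 gives constant 0 but nonconstant x*. *)

theory Defs
  imports "HOL-Analysis.Analysis"
begin

text \<open>
  Twice continuous Frechet differentiability on a set that need not be open: the
  function is of class C2 on some open neighbourhood of the set. For open \<open>S\<close> one
  can take \<open>W = S\<close>.
\<close>

definition C2_on :: "'a::real_normed_vector set \<Rightarrow> ('a \<Rightarrow> 'b::real_normed_vector) \<Rightarrow> bool" where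
  "C2_on S F \<longleftrightarrow>
     (\<exists>W (F' :: 'a \<Rightarrow> 'a \<Rightarrow>\<^sub>L 'b) (F'' :: 'a \<Rightarrow> 'a \<Rightarrow>\<^sub>L ('a \<Rightarrow>\<^sub>L 'b)).
        open W \<and> S \<subseteq> W \<and>
        (\<forall>z\<in>W. (F has_derivative blinfun_apply (F' z)) (at z)) \<and>
        (\<forall>z\<in>W. (F' has_derivative blinfun_apply (F'' z)) (at z)) \<and>
        continuous_on W F'')"

definition gradient :: "('a::real_inner \<Rightarrow> real) \<Rightarrow> 'a \<Rightarrow> 'a" where
  "gradient h x = (THE D. GDERIV h x :> D)"

definition strongly_convex :: "real \<Rightarrow> ('a::real_inner \<Rightarrow> real) \<Rightarrow> bool" where
  "strongly_convex \<alpha> h \<longleftrightarrow> 0 < \<alpha> \<and>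
     (\<forall>x y. \<forall>t\<in>{0..1}. h ((1 - t) *\<^sub>R x + t *\<^sub>R y)
        \<le> (1 - t) * h x + t * h y - \<alpha> / 2 * t * (1 - t) * (norm (x - y))\<^sup>2)"

definition pos_semidef :: "real ^ 'k ^ 'k \<Rightarrow> bool" where
  "pos_semidef A \<longleftrightarrow> transpose A = A \<and> (\<forall>v. 0 \<le> v \<bullet> (A *v v))"

definition loewner_le :: "real ^ 'k ^ 'k \<Rightarrow> real ^ 'k ^ 'k \<Rightarrow> bool" where
  "loewner_le A B \<longleftrightarrow> pos_semidef (B - A)"

text \<open>
  The number of rows of \<open>A\<^sub>I\<close> depends on the index set \<open>I\<close>, so it cannot be a type
  parameter. Matrices with rows (and columns) indexed by \<open>I\<close> are therefore represented
  by zero padding: \<open>rows_on I A\<close> stands for \<open>A\<^sub>I\<close> and \<open>mat_on I\<close> for the identity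
  matrix on the index set \<open>I\<close>. Padding changes neither operator norms nor the products
  \<open>A\<^sub>I A\<^sub>I\<^sup>T\<close> (up to padding), and a matrix that vanishes outside the \<open>I \<times> I\<close> block is
  positive semidefinite iff that block is. In particular \<open>rows_on {} A = 0\<close>.
\<close>

definition rows_on :: "'m set \<Rightarrow> real ^ 'n ^ 'm \<Rightarrow> real ^ 'n ^ 'm" where
  "rows_on I A = (\<chi> i. if i \<in> I then row i A else 0)"

definition mat_on :: "'m set \<Rightarrow> real ^ 'm ^ 'm" where
  "mat_on I = (\<chi> i j. if i = j \<and> i \<in> I then 1 else 0)"

text \<open>
  The problem with parameter \<open>\<xi>\<close> is to minimize \<open>f (x, \<xi>)\<close> over \<open>x\<close> subject to
  \<open>g (x, \<xi>) \<le> 0\<close>; the order on vectors is componentwise.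
\<close>

definition feasible :: "((real ^ 'n) \<times> (real ^ 'r) \<Rightarrow> real ^ 'm) \<Rightarrow> real ^ 'r \<Rightarrow> (real ^ 'n) set" where
  "feasible g \<xi> = {x. g (x, \<xi>) \<le> 0}"

definition active_set ::
    "((real ^ 'n) \<times> (real ^ 'r) \<Rightarrow> real ^ 'm) \<Rightarrow> real ^ 'r \<Rightarrow> real ^ 'n \<Rightarrow> 'm set" where
  "active_set g \<xi> x = {i. g (x, \<xi>) $ i = 0}"

definition lagrangian ::
    "((real ^ 'n) \<times> (real ^ 'r) \<Rightarrow> real) \<Rightarrow> ((real ^ 'n) \<times> (real ^ 'r) \<Rightarrow> real ^ 'm) \<Rightarrow>
     real ^ 'n \<Rightarrow> real ^ 'm \<Rightarrow> real ^ 'r \<Rightarrow> real" where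
  "lagrangian f g x \<mu> \<xi> = f (x, \<xi>) + \<mu> \<bullet> g (x, \<xi>)"

definition kkt_point ::
    "((real ^ 'n) \<times> (real ^ 'r) \<Rightarrow> real) \<Rightarrow> ((real ^ 'n) \<times> (real ^ 'r) \<Rightarrow> real ^ 'm) \<Rightarrow>
     real ^ 'r \<Rightarrow> real ^ 'n \<Rightarrow> real ^ 'm \<Rightarrow> bool" where
  "kkt_point f g \<xi> x \<mu> \<longleftrightarrow> x \<in> feasible g \<xi> \<and> 0 \<le> \<mu> \<and>
     gradient (\<lambda>y. lagrangian f g y \<mu> \<xi>) x = 0 \<and>
     (\<forall>i. g (x, \<xi>) $ i < 0 \<longrightarrow> \<mu> $ i = 0)"

definition primal_solutions ::
    "((real ^ 'n) \<times> (real ^ 'r) \<Rightarrow> real) \<Rightarrow> ((real ^ 'n) \<times> (real ^ 'r) \<Rightarrow> real ^ 'm) \<Rightarrow>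
     real ^ 'r \<Rightarrow> (real ^ 'n) set" where
  "primal_solutions f g \<xi> = {x \<in> feasible g \<xi>. \<forall>y\<in>feasible g \<xi>. f (x, \<xi>) \<le> f (y, \<xi>)}"

definition dual_solutions ::
    "((real ^ 'n) \<times> (real ^ 'r) \<Rightarrow> real) \<Rightarrow> ((real ^ 'n) \<times> (real ^ 'r) \<Rightarrow> real ^ 'm) \<Rightarrow>
     real ^ 'r \<Rightarrow> (real ^ 'm) set" where
  "dual_solutions f g \<xi> = {\<mu>. \<exists>x\<in>primal_solutions f g \<xi>. kkt_point f g \<xi> x \<mu>}"

definition x_star ::
    "((real ^ 'n) \<times> (real ^ 'r) \<Rightarrow> real) \<Rightarrow> ((real ^ 'n) \<times> (real ^ 'r) \<Rightarrow> real ^ 'm) \<Rightarrow>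
     real ^ 'r \<Rightarrow> real ^ 'n" where
  "x_star f g \<xi> = (THE x. x \<in> primal_solutions f g \<xi>)"

definition mu_star ::
    "((real ^ 'n) \<times> (real ^ 'r) \<Rightarrow> real) \<Rightarrow> ((real ^ 'n) \<times> (real ^ 'r) \<Rightarrow> real ^ 'm) \<Rightarrow>
     real ^ 'r \<Rightarrow> real ^ 'm" where
  "mu_star f g \<xi> = (THE \<mu>. \<mu> \<in> dual_solutions f g \<xi>)"

text \<open>In both matrices below the derivative in the parameter is taken with the primal and
  dual solutions frozen at their values for \<open>\<xi>\<close>.\<close>

definition L_star ::
    "((real ^ 'n) \<times> (real ^ 'r) \<Rightarrow> real) \<Rightarrow> ((real ^ 'n) \<times> (real ^ 'r) \<Rightarrow> real ^ 'm) \<Rightarrow>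
     real ^ 'r \<Rightarrow> real ^ 'r ^ 'n" where
  "L_star f g \<xi> =
     jacobian (\<lambda>\<eta>. gradient (\<lambda>x. lagrangian f g x (mu_star f g \<xi>) \<eta>) (x_star f g \<xi>)) (at \<xi>)"

definition G_star ::
    "((real ^ 'n) \<times> (real ^ 'r) \<Rightarrow> real) \<Rightarrow> ((real ^ 'n) \<times> (real ^ 'r) \<Rightarrow> real ^ 'm) \<Rightarrow>
     real ^ 'r \<Rightarrow> real ^ 'r ^ 'm" where
  "G_star f g \<xi> =
     rows_on (active_set g \<xi> (x_star f g \<xi>)) (jacobian (\<lambda>\<eta>. g (x_star f g \<xi>, \<eta>)) (at \<xi>))"

definition L_bar ::
    "((real ^ 'n) \<times> (real ^ 'r) \<Rightarrow> real) \<Rightarrow> ((real ^ 'n) \<times> (real ^ 'r) \<Rightarrow> real ^ 'm) \<Rightarrow>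
     (real ^ 'r) set \<Rightarrow> real" where
  "L_bar f g \<Xi> = (SUP \<xi>\<in>\<Xi>. onorm ((*v) (L_star f g \<xi>)))"

definition G_bar ::
    "((real ^ 'n) \<times> (real ^ 'r) \<Rightarrow> real) \<Rightarrow> ((real ^ 'n) \<times> (real ^ 'r) \<Rightarrow> real ^ 'm) \<Rightarrow>
     (real ^ 'r) set \<Rightarrow> real" where
  "G_bar f g \<Xi> = (SUP \<xi>\<in>\<Xi>. onorm ((*v) (G_star f g \<xi>)))"

end

theory Submission
  imports Defs
begin

text \<open>
  Fix a parameter \<open>\<xi>\<^sub>0\<close> and let \<open>dx\<close>, \<open>d\<mu>\<close>, \<open>d\<xi>\<close> be the increments to a nearby parameter \<open>\<xi>\<close>.
  Subtracting the two systems of KKT conditions and linearising at \<open>\<xi>\<^sub>0\<close> gives, up to an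
  error of smaller order than the three increments,
  \<open>H dx + A\<^sub>K\<^sup>T d\<mu> = - L\<^sup>\<star> d\<xi>\<close> and \<open>A\<^sub>K dx = - G\<^sup>\<star>\<^sub>K d\<xi>\<close>,
  where \<open>H\<close> is the Hessian of the Lagrangian, \<open>A\<close> is the Jacobian of the constraints and \<open>K\<close>
  is the set of the constraints active at both parameters. The set \<open>K\<close> depends on \<open>\<xi>\<close>, but
  continuity of the solution maps puts the support of \<open>d\<mu>\<close> inside \<open>K\<close>, and \<open>K\<close> is
  contained in the active set at \<open>\<xi>\<^sub>0\<close>. So every such system inherits the bound \<open>\<omega>\<close> on
  \<open>A\<^sub>K\<^sup>T\<close>, and changes of the active set need no separate treatment.

  The system is solved in the inner product \<open>\<langle>u, v\<rangle>\<^sub>H = u \<bullet> H v\<close>, for which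
  \<open>\<alpha> \<le> H \<le> B\<close> with \<open>B = \<beta> + \<Sum>\<^sub>i \<zeta>\<^sub>i \<l>\<^sub>i\<close>. If \<open>x\<^sub>0 = H\<inverse> u\<close> solves the first
  equation \<open>H x + A\<^sub>K\<^sup>T \<nu> = u\<close> without the multipliers, and \<open>p\<close> is the least-norm solution
  of the second equation \<open>A\<^sub>K x = w\<close>, then \<open>x - p\<close> and \<open>x - x\<^sub>0\<close> are \<open>H\<close>-orthogonal. Hence
  the \<open>H\<close>-norm of \<open>x\<close> is at most that of the pair \<open>(x\<^sub>0, p)\<close>, and comparing the two norms
  costs the factor \<open>\<surd>(B / \<alpha>)\<close> and no more. This is \<open>saddle_point_estimate\<close>; the symmetry of
  \<open>H\<close> it relies on is \<open>hessian_symmetric\<close>. It gives the constant \<open>B / \<omega>\<close> for the multipliers,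
  which is at most the one claimed because \<open>\<alpha> \<le> B\<close>.

  The linearisation needs continuity of the solution maps beforehand. For \<open>x\<^sup>\<star>\<close> it comes from
  comparing the Lagrangians with multipliers \<open>\<mu>\<^sup>\<star>(\<xi>)\<close> and \<open>\<mu>\<^sup>\<star>(\<xi>\<^sub>0)\<close> at the two optimizers, using
  strong convexity and the bounds \<open>\<zeta>\<close> on the multipliers (\<open>x_star_increment\<close>); for
  \<open>\<mu>\<^sup>\<star>\<close> it then follows from stationarity and the bound \<open>\<omega>\<close>. The resulting estimate
  \<open>solution_maps_solution_maps_local_estimate\<close> bounds the difference quotients at each parameter, and along
  the segments of the convex set \<open>\<Xi>\<close> such bounds add up to a global Lipschitz constant
  (\<open>lipschitz_on_if_locally\<close>).
\<close>

section \<open>Linear algebra of uniformly independent gradients\<close>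

abbreviation comb :: "('m::finite \<Rightarrow> real ^ 'n) \<Rightarrow> real ^ 'm \<Rightarrow> real ^ 'n" where
  "comb a \<nu> \<equiv> \<Sum>i\<in>UNIV. \<nu> $ i *\<^sub>R a i"

text \<open>For \<open>0 < \<omega>\<close> this is the quantitative linear independence of the vectors \<open>a i\<close> with
  \<open>i \<in> K\<close>: the least singular value of the matrix with these rows is at least \<open>\<omega>\<close>. Coefficient
  vectors are padded with zeros, so that \<open>K\<close> can vary while the types stay fixed.\<close>

definition unif_indep :: "real \<Rightarrow> 'm::finite set \<Rightarrow> ('m \<Rightarrow> real ^ 'n) \<Rightarrow> bool" where
  "unif_indep \<omega> K a \<longleftrightarrow>
     (\<forall>\<nu> :: real ^ 'm. (\<forall>i. i \<notin> K \<longrightarrow> \<nu> $ i = 0) \<longrightarrow> \<omega> * norm \<nu> \<le> norm (comb a \<nu>))"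

lemma unif_indep_subset: "unif_indep \<omega> K a \<Longrightarrow> K' \<subseteq> K \<Longrightarrow> unif_indep \<omega> K' a"
  unfolding unif_indep_def by blast

text \<open>The least-norm solution \<open>A\<^sup>T (A A\<^sup>T)\<inverse> w\<close> of \<open>A p = w\<close>, where \<open>A\<close> has the rows
  \<open>a i\<close> with \<open>i \<in> K\<close>. Its norm is controlled by \<open>\<bar>A\<^sup>T \<nu>\<bar>\<^sup>2 = \<nu> \<bullet> w\<close> together with
  \<open>\<omega> \<bar>\<nu>\<bar> \<le> \<bar>A\<^sup>T \<nu>\<bar>\<close>.\<close>

lemma unif_indep_solve:
  fixes a :: "'m::finite \<Rightarrow> real ^ 'n" and w :: "real ^ 'm"
  assumes ind: "unif_indep \<omega> K a" and \<omega>: "0 < \<omega>"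
  obtains \<nu> where "\<And>i. i \<notin> K \<Longrightarrow> \<nu> $ i = 0"
    and "\<And>i. i \<in> K \<Longrightarrow> a i \<bullet> comb a \<nu> = w $ i"
    and "norm (comb a \<nu>) \<le> norm w / \<omega>"
proof -
  define R where "R \<nu> = (\<chi> i. if i \<in> K then \<nu> $ i else 0)" for \<nu> :: "real ^ 'm"
  \<comment> \<open>The Gram matrix of the rows in \<open>K\<close>, extended by the identity off \<open>K\<close> to be invertible.\<close>
  define M where "M \<nu> = (\<chi> i. if i \<in> K then a i \<bullet> comb a (R \<nu>) else \<nu> $ i)" for \<nu> :: "real ^ 'm"
  have R_add: "R (x + y) = R x + R y" and R_scale: "R (c *\<^sub>R x) = c *\<^sub>R R x" for x y c
    by (simp_all add: R_def vec_eq_iff)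
  have lin: "linear M"
    by (rule linearI)
      (simp_all add: M_def R_add R_scale vec_eq_iff scaleR_add_left sum.distrib inner_add_right
        flip: scaleR_scaleR scaleR_sum_right)
  have sq: "comb a \<nu> \<bullet> comb a \<nu> = \<nu> \<bullet> w'"
    if "\<And>i. i \<notin> K \<Longrightarrow> \<nu> $ i = 0" "\<And>i. i \<in> K \<Longrightarrow> a i \<bullet> comb a \<nu> = w' $ i" for \<nu> w'
  proof -
    have "comb a \<nu> \<bullet> comb a \<nu> = (\<Sum>i\<in>UNIV. \<nu> $ i * (a i \<bullet> comb a \<nu>))"
      by (simp add: inner_sum_left)
    also have "\<dots> = (\<Sum>i\<in>UNIV. \<nu> $ i * w' $ i)"
      by (rule sum.cong) (use that in fastforce)+
    finally show ?thesis by (simp add: inner_vec_def)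
  qed
  have RK: "R \<nu> = \<nu>" if "\<And>i. i \<notin> K \<Longrightarrow> \<nu> $ i = 0" for \<nu>
    using that by (simp add: R_def vec_eq_iff)
  have "inj M"
  proof (subst linear_injective_0[OF lin], intro allI impI)
    fix \<nu> assume 0: "M \<nu> = 0"
    have off: "\<nu> $ i = 0" if "i \<notin> K" for i
      using arg_cong[OF 0, of "\<lambda>v. v $ i"] that by (simp add: M_def)
    have on: "a i \<bullet> comb a \<nu> = (0::real^'m) $ i" if "i \<in> K" for i
      using arg_cong[OF 0, of "\<lambda>v. v $ i"] that by (simp add: M_def RK[OF off])
    have "comb a \<nu> \<bullet> comb a \<nu> = 0" using sq[OF off on] by simp
    then have "\<omega> * norm \<nu> \<le> 0" using ind off unfolding unif_indep_def by fastforce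
    then show "\<nu> = 0" using \<omega> by (simp add: mult_le_0_iff)
  qed
  with lin have "surj M" by (rule linear_injective_imp_surjective) simp
  then obtain \<nu> where \<nu>: "M \<nu> = R w" by (metis surjD)
  have off: "\<nu> $ i = 0" if "i \<notin> K" for i
    using arg_cong[OF \<nu>, of "\<lambda>v. v $ i"] that by (simp add: M_def R_def)
  have on: "a i \<bullet> comb a \<nu> = w $ i" if "i \<in> K" for i
    using arg_cong[OF \<nu>, of "\<lambda>v. v $ i"] that
    by (simp add: M_def RK[OF off] R_def[of w])
  have "\<omega> * norm \<nu> \<le> norm (comb a \<nu>)" using ind off unfolding unif_indep_def by blast
  moreover have "norm (comb a \<nu>) ^ 2 \<le> norm \<nu> * norm w"
    using sq[OF off on] norm_cauchy_schwarz[of \<nu> w] by (simp add: power2_norm_eq_inner)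
  ultimately have "\<omega> * norm (comb a \<nu>) ^ 2 \<le> norm (comb a \<nu>) * norm w"
    using \<omega> by (smt (verit) mult.assoc mult_left_mono mult_right_mono norm_ge_zero)
  then have "norm (comb a \<nu>) * (\<omega> * norm (comb a \<nu>)) \<le> norm (comb a \<nu>) * norm w"
    by (simp add: power2_eq_square algebra_simps)
  then have "\<omega> * norm (comb a \<nu>) \<le> norm w"
    by (cases "norm (comb a \<nu>) = 0") (auto simp: mult_le_cancel_left)
  then have "norm (comb a \<nu>) \<le> norm w / \<omega>" using \<omega> by (simp add: field_simps)
  then show ?thesis using that off on by blast
qed

text \<open>Let \<open>x0 = H\<inverse> u\<close>, and let \<open>p\<close> be the least-norm vector that satisfies the constraints
  in \<open>K\<close>. Then \<open>x - p\<close> is annihilated by the constraints in \<open>K\<close>, and \<open>H (x - x0)\<close> is a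
  combination of their gradients, so \<open>x - p\<close> and \<open>x - x0\<close> are orthogonal for the inner
  product defined by \<open>H\<close>. Both estimates follow from this right angle. Working in the \<open>H\<close>-norm
  to the end is what yields \<open>\<surd>(B / \<alpha>)\<close> in place of the condition number \<open>B / \<alpha>\<close>.\<close>

lemma saddle_point_estimate:
  fixes H :: "real ^ 'n \<Rightarrow> real ^ 'n" and a :: "'m::finite \<Rightarrow> real ^ 'n" and w :: "real ^ 'm"
  assumes lin: "linear H" and sym: "\<And>u v. u \<bullet> H v = v \<bullet> H u"
    and \<alpha>: "0 < \<alpha>" "\<And>v. \<alpha> * (norm v)\<^sup>2 \<le> v \<bullet> H v"
    and B: "0 < B" "\<And>v. v \<bullet> H v \<le> B * (norm v)\<^sup>2"
    and ind: "unif_indep \<omega> K a" "0 < \<omega>"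
    and supp: "\<And>i. i \<notin> K \<Longrightarrow> \<nu> $ i = 0"
    and eq1: "H x + comb a \<nu> = u" and eq2: "\<And>i. i \<in> K \<Longrightarrow> a i \<bullet> x = w $ i"
  shows "norm x \<le> sqrt (B / \<alpha>) * (norm u / \<alpha> + norm w / \<omega>)"
    and "norm \<nu> \<le> B / \<omega> * (norm u / \<alpha> + norm w / \<omega>)"
proof -
  let ?s = "norm u / \<alpha> + norm w / \<omega>"
  have "inj H"
  proof (subst linear_injective_0[OF lin], intro allI impI)
    fix v assume "H v = 0"
    then have "\<alpha> * (norm v)\<^sup>2 \<le> 0" using \<alpha>(2)[of v] by simp
    then show "v = 0" using \<alpha>(1) by (simp add: mult_le_0_iff)
  qed
  with lin have "surj H" by (rule linear_injective_imp_surjective) simp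
  then obtain x0 where x0: "H x0 = u" by (metis surjD)
  have nx0: "norm x0 \<le> norm u / \<alpha>"
  proof -
    have "norm x0 * (\<alpha> * norm x0) \<le> norm x0 * norm u"
      using \<alpha>(2)[of x0] norm_cauchy_schwarz[of x0 u] x0 by (simp add: power2_eq_square algebra_simps)
    then have "\<alpha> * norm x0 \<le> norm u" by (cases "x0 = 0") (auto simp: mult_le_cancel_left)
    then show ?thesis using \<alpha>(1) by (simp add: field_simps)
  qed
  obtain \<kappa> where np: "norm (comb a \<kappa>) \<le> norm w / \<omega>"
    and ap: "\<And>i. i \<in> K \<Longrightarrow> a i \<bullet> comb a \<kappa> = w $ i"
    by (rule unif_indep_solve[OF ind]) blast
  define p where "p = comb a \<kappa>"
  note add = linear_add[OF lin] and diff = linear_diff[OF lin] and scale = linear_scale[OF lin]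
  have Hz: "H (x - x0) = - comb a \<nu>" using eq1 x0 by (simp add: diff algebra_simps)
  have orth: "(x - p) \<bullet> H (x - x0) = 0"
  proof -
    have "(x - p) \<bullet> comb a \<nu> = (\<Sum>i\<in>UNIV. \<nu> $ i * (a i \<bullet> (x - p)))"
      by (simp add: inner_sum_right inner_commute)
    also have "\<dots> = 0"
      by (rule sum.neutral) (use supp eq2 ap in \<open>fastforce simp: p_def inner_diff_right\<close>)
    finally show ?thesis by (simp add: Hz)
  qed
  have pos: "0 \<le> v \<bullet> H v" for v using \<alpha> order_trans by (meson mult_nonneg_nonneg less_imp_le zero_le_power2)
  have s: "norm x0 + norm p \<le> ?s" using nx0 np p_def by simp
  have s0: "0 \<le> ?s" using \<alpha>(1) ind(2) by simp
  have "\<alpha> * (norm x)\<^sup>2 \<le> x \<bullet> H x" by (rule \<alpha>)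
  \<comment> \<open>By orthogonality the right-hand side exceeds the left-hand side by exactly the
    squared \<open>H\<close>-norm of \<open>x0 + p - x\<close>.\<close>
  also have "\<dots> \<le> x0 \<bullet> H x0 + p \<bullet> H p"
    using pos[of "x0 + p - x"] orth sym[of x x0] sym[of x p] sym[of x0 p]
    by (simp add: add diff inner_add_left inner_add_right inner_diff_left inner_diff_right)
  also have "\<dots> \<le> B * (norm x0)\<^sup>2 + B * (norm p)\<^sup>2" using B(2) by (meson add_mono)
  also have "\<dots> = B * ((norm x0)\<^sup>2 + (norm p)\<^sup>2)" by (simp add: algebra_simps)
  also have "\<dots> \<le> B * (norm x0 + norm p)\<^sup>2"
    using B(1) by (intro mult_left_mono) (auto simp: power2_sum)
  also have "\<dots> \<le> B * ?s\<^sup>2" using B(1) s by (intro mult_left_mono power_mono) auto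
  finally have "(norm x)\<^sup>2 \<le> B / \<alpha> * ?s\<^sup>2" using \<alpha>(1) by (simp add: field_simps)
  then have "norm x \<le> sqrt (B / \<alpha> * ?s\<^sup>2)" by (rule real_le_rsqrt)
  then have "norm x \<le> sqrt (B / \<alpha>) * sqrt (?s\<^sup>2)" by (simp only: real_sqrt_mult)
  then show "norm x \<le> sqrt (B / \<alpha>) * ?s" using s0 by simp
  define z where "z = x - x0"
  \<comment> \<open>Pythagoras for \<open>x0 - p = (x - p) - (x - x0)\<close>.\<close>
  have "z \<bullet> H z \<le> (x0 - p) \<bullet> H (x0 - p)"
    using pos[of "x - p"] orth sym[of x x0] sym[of x p] sym[of x0 p]
    by (simp add: z_def diff inner_diff_left inner_diff_right)
  also have "\<dots> \<le> B * (norm (x0 - p))\<^sup>2" by (rule B)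
  also have "\<dots> \<le> B * ?s\<^sup>2"
    using B(1) s norm_triangle_ineq4[of x0 p] by (intro mult_left_mono power_mono) auto
  finally have zz: "z \<bullet> H z \<le> B * ?s\<^sup>2" .
  \<comment> \<open>The bound \<open>\<bar>H z\<bar>\<^sup>2 \<le> B (z \<bullet> H z)\<close>: evaluate the quadratic form after one gradient step
    of length \<open>1 / B\<close> from \<open>z\<close>.\<close>
  have "0 \<le> (z - (1/B) *\<^sub>R H z) \<bullet> H (z - (1/B) *\<^sub>R H z)" by (rule pos)
  also have "\<dots> = z \<bullet> H z - 2 / B * (norm (H z))\<^sup>2 + (1/B)\<^sup>2 * (H z \<bullet> H (H z))"
    using sym[of z "H z"] unfolding power2_norm_eq_inner
    by (simp add: diff scale inner_diff_left inner_diff_right power2_eq_square algebra_simps)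
  also have "\<dots> \<le> z \<bullet> H z - 2 / B * (norm (H z))\<^sup>2 + (1/B)\<^sup>2 * (B * (norm (H z))\<^sup>2)"
    using B(2)[of "H z"] by (intro add_left_mono mult_left_mono) auto
  also have "\<dots> = z \<bullet> H z - (norm (H z))\<^sup>2 / B" using B(1) by (simp add: power2_eq_square field_simps)
  finally have "(norm (H z))\<^sup>2 \<le> B * (z \<bullet> H z)" using B(1) by (simp add: field_simps)
  also have "\<dots> \<le> B * (B * ?s\<^sup>2)" using zz B(1) by (intro mult_left_mono) auto
  also have "\<dots> = (B * ?s)\<^sup>2" by (simp add: power2_eq_square algebra_simps)
  finally have "norm (H z) \<le> B * ?s" using s0 B(1) by (simp add: power2_le_iff_abs_le)
  moreover have "\<omega> * norm \<nu> \<le> norm (H z)"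
    using ind(1) supp Hz unfolding unif_indep_def z_def by simp
  ultimately have "\<omega> * norm \<nu> \<le> B * ?s" by linarith
  then have "norm \<nu> \<le> B * ?s / \<omega>" using ind(2) by (simp add: pos_le_divide_eq mult.commute)
  then show "norm \<nu> \<le> B / \<omega> * ?s" by simp
qed

text \<open>Farkas' lemma for linearly independent vectors. Independence makes it elementary: a
  direction that strictly decreases every constraint exists, which relaxes the hypothesis to
  directions with \<open>a i \<bullet> d \<le> 0\<close>; the component of \<open>c\<close> orthogonal to all \<open>a i\<close> then
  vanishes; and the sign of each coefficient is read off from a direction that decreases
  one constraint and leaves the others unchanged.\<close>

lemma multipliers_exist:
  fixes a :: "'m::finite \<Rightarrow> real ^ 'n"
  assumes ind: "unif_indep \<omega> K a" "0 < \<omega>"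
    and c: "\<And>d. (\<And>i. i \<in> K \<Longrightarrow> a i \<bullet> d < 0) \<Longrightarrow> 0 \<le> c \<bullet> d"
  obtains \<mu> where "0 \<le> \<mu>" "\<And>i. i \<notin> K \<Longrightarrow> \<mu> $ i = 0" "c + comb a \<mu> = 0"
proof -
  obtain \<nu>1 where \<nu>1: "\<And>i. i \<in> K \<Longrightarrow> a i \<bullet> comb a \<nu>1 = (vec (-1) :: real ^ 'm) $ i"
    by (rule unif_indep_solve[OF ind]) blast
  define d1 where "d1 = comb a \<nu>1"
  have d1: "a i \<bullet> d1 = -1" if "i \<in> K" for i using \<nu>1[OF that] by (simp add: d1_def)
  \<comment> \<open>Tilt \<open>d\<close> slightly into the strictly decreasing direction \<open>d1\<close> and let the tilt tend to \<open>0\<close>.\<close>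
  have c': "0 \<le> c \<bullet> d" if d: "\<And>i. i \<in> K \<Longrightarrow> a i \<bullet> d \<le> 0" for d
  proof (rule tendsto_lowerbound)
    show "((\<lambda>s. c \<bullet> (d + s *\<^sub>R d1)) \<longlongrightarrow> c \<bullet> d) (at_right 0)"
      by (rule tendsto_eq_intros refl)+ simp
    show "\<forall>\<^sub>F s in at_right 0. 0 \<le> c \<bullet> (d + s *\<^sub>R d1)"
      using eventually_at_right_less[of "0::real"]
    proof eventually_elim
      case (elim s)
      have "a i \<bullet> (d + s *\<^sub>R d1) < 0" if "i \<in> K" for i
        using d[OF that] d1[OF that] elim by (simp add: inner_add_right)
      then show ?case by (rule c)
    qed
  qed simp
  obtain \<nu> where \<nu>: "\<And>i. i \<notin> K \<Longrightarrow> \<nu> $ i = 0"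
      "\<And>i. i \<in> K \<Longrightarrow> a i \<bullet> comb a \<nu> = (\<chi> i. a i \<bullet> c) $ i"
    by (rule unif_indep_solve[OF ind]) blast
  define r where "r = c - comb a \<nu>"
  have ar: "a i \<bullet> r = 0" if "i \<in> K" for i
    using \<nu>(2)[OF that] by (simp add: r_def inner_diff_right)
  have comb_inner: "comb a \<nu> \<bullet> d = (\<Sum>i\<in>UNIV. \<nu> $ i * (a i \<bullet> d))" for d
    by (simp add: inner_sum_left)
  have "comb a \<nu> \<bullet> r = 0"
    unfolding comb_inner by (rule sum.neutral) (use \<nu>(1) ar in fastforce)
  then have "c \<bullet> r = r \<bullet> r" by (simp add: r_def inner_diff_left)
  moreover have "0 \<le> c \<bullet> (- r)" by (rule c') (simp add: ar)
  ultimately have "r \<bullet> r \<le> 0" by simp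
  then have "r = 0" by (metis inner_gt_zero_iff not_le)
  then have ceq: "c = comb a \<nu>" by (simp add: r_def)
  have neg: "\<nu> $ i \<le> 0" for i
  proof (cases "i \<in> K")
    case True
    obtain \<kappa> where "\<And>j. j \<in> K \<Longrightarrow> a j \<bullet> comb a \<kappa> = (\<chi> j. if j = i then -1 else 0) $ j"
      by (rule unif_indep_solve[OF ind]) blast
    then have l: "\<And>j. j \<in> K \<Longrightarrow> a j \<bullet> comb a \<kappa> = (if j = i then -1 else 0)" by simp
    have "0 \<le> c \<bullet> comb a \<kappa>" by (rule c') (simp add: l)
    also have "\<dots> = (\<Sum>j\<in>UNIV. if j = i then - \<nu> $ j else 0)"
      unfolding ceq comb_inner
    proof (rule sum.cong[OF refl])
      fix j show "\<nu> $ j * (a j \<bullet> comb a \<kappa>) = (if j = i then - \<nu> $ j else 0)"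
        using True by (cases "j \<in> K") (auto simp: \<nu>(1) l)
    qed
    also have "\<dots> = - \<nu> $ i" by simp
    finally show ?thesis by simp
  qed (use \<nu>(1) in simp)
  show ?thesis
  proof
    show "0 \<le> - \<nu>" using neg by (simp add: less_eq_vec_def)
    show "(- \<nu>) $ i = 0" if "i \<notin> K" for i using \<nu>(1)[OF that] by simp
    show "c + comb a (- \<nu>) = 0" using ceq by (simp add: sum_negf)
  qed
qed

section \<open>Gradients, Hessians and convexity\<close>

lemma gradient_eqI:
  assumes "GDERIV h x :> D" shows "gradient h x = D"
  unfolding gradient_def
proof (rule the_equality)
  show "GDERIV h x :> D" by (fact assms)
next
  fix D' assume "GDERIV h x :> D'"
  then have "(\<lambda>v. v \<bullet> D') = (\<lambda>v. v \<bullet> D)"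
    using assms unfolding gderiv_def by (rule has_derivative_unique)
  then show "D' = D" by (metis vector_eq_ldot)
qed

text \<open>One-sided difference quotients, tested against a vector \<open>b\<close> so that order arguments apply.
  For real-valued \<open>G\<close> one takes \<open>b = 1\<close>.\<close>

lemma directional_quotient:
  fixes G :: "'a::real_normed_vector \<Rightarrow> 'b::real_inner"
  assumes "(G has_derivative H) (at x)"
  shows "((\<lambda>t. b \<bullet> (G (x + t *\<^sub>R v) - G x) / t) \<longlongrightarrow> b \<bullet> H v) (at_right 0)"
proof -
  have lin: "linear H" using assms has_derivative_linear by blast
  have "((\<lambda>t::real. x + t *\<^sub>R v) has_derivative (\<lambda>t. t *\<^sub>R v)) (at 0)"
    by (auto intro!: derivative_eq_intros)
  moreover have "(G has_derivative H) (at (x + 0 *\<^sub>R v))" using assms by simp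
  ultimately have "((\<lambda>t. G (x + t *\<^sub>R v)) has_derivative (\<lambda>t. H (t *\<^sub>R v))) (at 0)"
    by (rule has_derivative_compose)
  then have "((\<lambda>t. b \<bullet> G (x + t *\<^sub>R v)) has_derivative (\<lambda>t. b \<bullet> H (t *\<^sub>R v))) (at 0)"
    by (rule has_derivative_inner_right)
  then have "((\<lambda>t. b \<bullet> G (x + t *\<^sub>R v)) has_real_derivative b \<bullet> H v) (at 0)"
    by (rule has_derivative_imp_has_field_derivative) (simp add: linear_scale[OF lin])
  then have "(\<lambda>t. (b \<bullet> G (x + (0 + t) *\<^sub>R v) - b \<bullet> G (x + 0 *\<^sub>R v)) / t) \<midarrow>0\<rightarrow> b \<bullet> H v"
    by (rule DERIV_D)
  then have "((\<lambda>t. b \<bullet> (G (x + t *\<^sub>R v) - G x) / t) \<longlongrightarrow> b \<bullet> H v) (at 0)"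
    by (simp add: inner_diff_right)
  then show ?thesis by (rule filterlim_mono) (auto simp: at_le)
qed

text \<open>The first-order lower bound for modulus \<open>c\<close>; the case \<open>c = 0\<close> is plain convexity.\<close>

lemma convex_gradient_bound:
  fixes h :: "'a::real_inner \<Rightarrow> real"
  assumes conv: "\<And>x y t. t \<in> {0..1} \<Longrightarrow>
      h ((1 - t) *\<^sub>R x + t *\<^sub>R y) \<le> (1 - t) * h x + t * h y - c / 2 * t * (1 - t) * (norm (x - y))\<^sup>2"
    and D: "GDERIV h x :> D"
  shows "h x + (y - x) \<bullet> D + c / 2 * (norm (y - x))\<^sup>2 \<le> h y"
proof -
  let ?v = "y - x"
  have "((\<lambda>t. 1 \<bullet> (h (x + t *\<^sub>R ?v) - h x) / t) \<longlongrightarrow> 1 \<bullet> (?v \<bullet> D)) (at_right 0)"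
    using D unfolding gderiv_def by (rule directional_quotient)
  moreover have "((\<lambda>t. h y - h x - c / 2 * (1 - t) * (norm ?v)\<^sup>2) \<longlongrightarrow>
      h y - h x - c / 2 * (1 - 0) * (norm ?v)\<^sup>2) (at_right 0)"
    by (intro tendsto_intros)
  moreover have "\<forall>\<^sub>F t in at_right 0.
      1 \<bullet> (h (x + t *\<^sub>R ?v) - h x) / t \<le> h y - h x - c / 2 * (1 - t) * (norm ?v)\<^sup>2"
    using eventually_at_right_real[of 0 1, OF zero_less_one]
  proof eventually_elim
    case (elim t)
    then have t: "0 < t" "t \<in> {0..1}" by auto
    have "x + t *\<^sub>R ?v = (1 - t) *\<^sub>R x + t *\<^sub>R y" by (simp add: algebra_simps)
    then have "h (x + t *\<^sub>R ?v) - h x \<le> t * (h y - h x - c / 2 * (1 - t) * (norm ?v)\<^sup>2)"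
      using conv[OF t(2), of x y] by (simp add: norm_minus_commute algebra_simps)
    then show ?case using t(1) by (simp add: field_simps)
  qed
  ultimately have "1 \<bullet> (?v \<bullet> D) \<le> h y - h x - c / 2 * (1 - 0) * (norm ?v)\<^sup>2"
    by (intro tendsto_le[OF trivial_limit_at_right_real])
  then show ?thesis by simp
qed

lemma strongly_convex_gradient_bound:
  assumes "strongly_convex \<alpha> h" and "GDERIV h x :> D"
  shows "h x + (y - x) \<bullet> D + \<alpha> / 2 * (norm (y - x))\<^sup>2 \<le> h y"
  using assms by (intro convex_gradient_bound) (auto simp: strongly_convex_def)

lemma convex_on_gradient_bound:
  assumes "convex_on UNIV h" and "GDERIV h x :> D"
  shows "h x + (y - x) \<bullet> D \<le> h y"
  using convex_gradient_bound[of h 0 x D y] assms by (auto simp: convex_on_def)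

text \<open>The quadratic lower bound at any feasible point \<open>x1\<close> confines the points with value at most
  \<open>h x1\<close> to a ball around \<open>x1\<close>, so compactness gives a minimizer; two minimizers
  would be beaten by their midpoint.\<close>

lemma strongly_convex_unique_minimizer:
  fixes h :: "'a::euclidean_space \<Rightarrow> real"
  assumes sc: "strongly_convex \<alpha> h" and D: "\<And>x. GDERIV h x :> D x"
    and S: "closed S" "convex S" "S \<noteq> {}"
  shows "\<exists>!x. x \<in> S \<and> (\<forall>y\<in>S. h x \<le> h y)"
proof -
  have \<alpha>: "0 < \<alpha>" using sc by (simp add: strongly_convex_def)
  obtain x1 where x1: "x1 \<in> S" using S by blast
  let ?R = "2 * norm (D x1) / \<alpha>"
  have "continuous_on (S \<inter> cball x1 ?R) h"
    using D has_derivative_continuous unfolding gderiv_def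
    by (meson continuous_at_imp_continuous_on)
  moreover have "compact (S \<inter> cball x1 ?R)" using S by (simp add: closed_Int_compact)
  moreover have "x1 \<in> S \<inter> cball x1 ?R" using x1 \<alpha> by simp
  ultimately obtain x where x: "x \<in> S \<inter> cball x1 ?R" "\<And>y. y \<in> S \<inter> cball x1 ?R \<Longrightarrow> h x \<le> h y"
    using continuous_attains_inf by (metis empty_iff)
  have min: "h x \<le> h y" if "y \<in> S" for y
  proof (cases "y \<in> cball x1 ?R")
    case False
    then have "2 * norm (D x1) < \<alpha> * norm (y - x1)"
      using \<alpha> by (simp add: dist_norm norm_minus_commute field_simps)
    then have "2 * norm (D x1) * norm (y - x1) \<le> \<alpha> * norm (y - x1) * norm (y - x1)"
      by (intro mult_right_mono) auto
    moreover have "- (norm (y - x1) * norm (D x1)) \<le> (y - x1) \<bullet> D x1"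
      using norm_cauchy_schwarz[of "x1 - y" "D x1"] by (simp add: inner_diff_left norm_minus_commute)
    moreover have "h x1 + (y - x1) \<bullet> D x1 + \<alpha> / 2 * (norm (y - x1))\<^sup>2 \<le> h y"
      by (rule strongly_convex_gradient_bound[OF sc D])
    ultimately have "h x1 \<le> h y" by (simp add: power2_eq_square algebra_simps)
    moreover have "h x \<le> h x1" using x(2) x1 \<alpha> by simp
    ultimately show ?thesis by simp
  qed (use x that in blast)
  show ?thesis
  proof (rule ex1I)
    show "x \<in> S \<and> (\<forall>y\<in>S. h x \<le> h y)" using x min by blast
  next
    fix x' assume x': "x' \<in> S \<and> (\<forall>y\<in>S. h x' \<le> h y)"
    let ?m = "(1 - 1/2) *\<^sub>R x + (1/2) *\<^sub>R x'"
    have "?m \<in> S" using S(2) x x' by (intro convexD_alt) auto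
    then have "h x \<le> h ?m" "h x' \<le> h ?m" using min x' by blast+
    moreover have "h ((1 - t) *\<^sub>R x + t *\<^sub>R x') \<le>
        (1 - t) * h x + t * h x' - \<alpha> / 2 * t * (1 - t) * (norm (x - x'))\<^sup>2" if "t \<in> {0..1}" for t
      using sc that unfolding strongly_convex_def by blast
    from this[of "1/2"] have "h ?m \<le> (1 - 1/2) * h x + 1/2 * h x' - \<alpha> / 2 * (1/2) * (1 - 1/2) * (norm (x - x'))\<^sup>2"
      by simp
    ultimately have "\<alpha> * (norm (x - x'))\<^sup>2 \<le> 0" by simp
    then show "x' = x" using \<alpha> by (simp add: mult_le_0_iff)
  qed
qed

text \<open>The second difference \<open>\<Delta> u v t\<close> is symmetric in \<open>u\<close> and \<open>v\<close>, and \<open>\<Delta> u v t / t\<^sup>2\<close> tends to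
  \<open>u \<bullet> H v\<close>. For the limit, the mean value theorem is applied along \<open>u\<close> and the resulting
  difference of gradients is expanded at \<open>x\<close>.\<close>

lemma hessian_symmetric:
  fixes h :: "'a::real_inner \<Rightarrow> real"
  assumes G: "\<And>y. GDERIV h y :> G y" and H: "(G has_derivative H) (at x)"
  shows "u \<bullet> H v = v \<bullet> H u"
proof -
  define \<Delta> where "\<Delta> u v t = h (x + t *\<^sub>R u + t *\<^sub>R v) - h (x + t *\<^sub>R u) - h (x + t *\<^sub>R v) + h x" for u v t
  have lin: "linear H" using H has_derivative_linear by blast
  have lim: "((\<lambda>t. \<Delta> u v t / t\<^sup>2) \<longlongrightarrow> u \<bullet> H v) (at_right 0)" for u v
  proof (rule tendstoI)
    fix \<epsilon> :: real assume "0 < \<epsilon>"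
    let ?c = "norm u + norm v"
    define e where "e = \<epsilon> / (2 * ?c * norm u + 1)"
    have e: "0 < e" "e * (2 * ?c * norm u) < \<epsilon>"
      using \<open>0 < \<epsilon>\<close> by (auto simp: e_def field_simps add_pos_nonneg)
    then obtain d where d: "0 < d" "\<And>y. norm (y - x) < d \<Longrightarrow> norm (G y - G x - H (y - x)) \<le> e * norm (y - x)"
      using H unfolding has_derivative_at_alt by blast
    have "0 < d / (?c + 1)" using d by (simp add: add_nonneg_pos)
    from eventually_at_right_real[OF this]
    show "\<forall>\<^sub>F t in at_right 0. dist (\<Delta> u v t / t\<^sup>2) (u \<bullet> H v) < \<epsilon>"
    proof eventually_elim
      case (elim t)
      moreover have "0 < ?c + 1" by (simp add: add_nonneg_pos)
      ultimately have t: "0 < t" "t * (?c + 1) < d" by (auto simp: pos_less_divide_eq)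
      \<comment> \<open>The first difference along \<open>v\<close>, as a function of the displacement along \<open>u\<close>.\<close>
      define \<phi> where "\<phi> s = h (x + s *\<^sub>R u + t *\<^sub>R v) - h (x + s *\<^sub>R u)" for s
      have "(\<phi> has_real_derivative u \<bullet> (G (x + s *\<^sub>R u + t *\<^sub>R v) - G (x + s *\<^sub>R u))) (at s)" for s
      proof -
        have h: "(h has_derivative (\<lambda>k. k \<bullet> G y)) (at y)" for y using G unfolding gderiv_def .
        have "((\<lambda>s. x + s *\<^sub>R u + t *\<^sub>R v) has_derivative (\<lambda>k. k *\<^sub>R u)) (at s)"
             "((\<lambda>s. x + s *\<^sub>R u) has_derivative (\<lambda>k. k *\<^sub>R u)) (at s)"
          by (auto intro!: derivative_eq_intros)
        from this[THEN has_derivative_compose, OF h]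
        have "(\<phi> has_derivative (\<lambda>k. (k *\<^sub>R u) \<bullet> G (x + s *\<^sub>R u + t *\<^sub>R v) - (k *\<^sub>R u) \<bullet> G (x + s *\<^sub>R u))) (at s)"
          unfolding \<phi>_def by (rule has_derivative_diff)
        then show ?thesis
          by (rule has_derivative_imp_has_field_derivative) (simp add: inner_diff_right algebra_simps)
      qed
      from MVT2[OF t(1) this] obtain s where s: "0 < s" "s < t"
        and mvt: "\<phi> t - \<phi> 0 = t * (u \<bullet> (G (x + s *\<^sub>R u + t *\<^sub>R v) - G (x + s *\<^sub>R u)))"
        by (auto simp: algebra_simps)
      have r: "norm (G (x + k) - G x - H k) \<le> e * (t * ?c)" if "norm k \<le> t * ?c" for k
      proof -
        have "norm (x + k - x) < d" using that t by (simp add: algebra_simps)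
        from d(2)[OF this] have "norm (G (x + k) - G x - H k) \<le> e * norm k" by simp
        also have "\<dots> \<le> e * (t * ?c)" using e that by (intro mult_left_mono) auto
        finally show ?thesis .
      qed
      define r1 where "r1 = G (x + (s *\<^sub>R u + t *\<^sub>R v)) - G x - H (s *\<^sub>R u + t *\<^sub>R v)"
      define r2 where "r2 = G (x + s *\<^sub>R u) - G x - H (s *\<^sub>R u)"
      have su: "s * norm u \<le> t * norm u" using s by (intro mult_right_mono) auto
      have "norm (s *\<^sub>R u + t *\<^sub>R v) \<le> t * ?c"
        using norm_triangle_ineq[of "s *\<^sub>R u" "t *\<^sub>R v"] s t su by (simp add: distrib_left)
      then have n1: "norm r1 \<le> e * (t * ?c)" unfolding r1_def by (rule r)
      have "norm (s *\<^sub>R u) \<le> t * ?c" using su s t by (simp add: distrib_left add_increasing2)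
      then have n2: "norm r2 \<le> e * (t * ?c)" unfolding r2_def by (rule r)
      have Gd: "G (x + s *\<^sub>R u + t *\<^sub>R v) - G (x + s *\<^sub>R u) = t *\<^sub>R H v + (r1 - r2)"
        by (simp add: r1_def r2_def linear_add[OF lin] linear_scale[OF lin] add.assoc)
      have "\<Delta> u v t = \<phi> t - \<phi> 0" by (simp add: \<Delta>_def \<phi>_def)
      also have "\<dots> = t\<^sup>2 * (u \<bullet> H v) + t * (u \<bullet> (r1 - r2))"
        unfolding mvt Gd by (simp add: inner_add_right power2_eq_square distrib_left)
      finally have "\<Delta> u v t / t\<^sup>2 - u \<bullet> H v = u \<bullet> (r1 - r2) / t"
        using t(1) by (simp add: field_simps power2_eq_square)
      moreover have "\<bar>u \<bullet> (r1 - r2)\<bar> \<le> norm u * (2 * (e * (t * ?c)))"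
      proof -
        have "\<bar>u \<bullet> (r1 - r2)\<bar> \<le> norm u * norm (r1 - r2)" by (rule Cauchy_Schwarz_ineq2)
        also have "\<dots> \<le> norm u * (2 * (e * (t * ?c)))"
          using norm_triangle_ineq4[of r1 r2] n1 n2 by (intro mult_left_mono) auto
        finally show ?thesis .
      qed
      then have "\<bar>u \<bullet> (r1 - r2)\<bar> / t \<le> e * (2 * ?c * norm u)"
        using t(1) by (simp add: pos_divide_le_eq algebra_simps)
      ultimately have "\<bar>\<Delta> u v t / t\<^sup>2 - u \<bullet> H v\<bar> \<le> e * (2 * ?c * norm u)"
        using t(1) by simp
      also have "\<dots> < \<epsilon>" by (rule e)
      finally show ?case by (simp add: dist_real_def)
    qed
  qed
  have "\<Delta> u v t = \<Delta> v u t" for t by (simp add: \<Delta>_def add.assoc add.commute[of "t *\<^sub>R u"])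
  then show ?thesis
    using tendsto_unique[OF trivial_limit_at_right_real lim[of u v]] lim[of v u] by simp
qed

lemma derivative_monotone:
  fixes G :: "'a::real_inner \<Rightarrow> 'a"
  assumes H: "(G has_derivative H) (at x)"
    and mono: "\<And>y. c * (norm (y - x))\<^sup>2 \<le> (y - x) \<bullet> (G y - G x)"
  shows "c * (norm v)\<^sup>2 \<le> v \<bullet> H v"
proof (rule tendsto_lowerbound[OF directional_quotient[OF H]])
  show "\<forall>\<^sub>F t in at_right 0. c * (norm v)\<^sup>2 \<le> v \<bullet> (G (x + t *\<^sub>R v) - G x) / t"
    using eventually_at_right_less[of "0::real"]
  proof eventually_elim
    case (elim t)
    have "t * (t * (c * (norm v)\<^sup>2)) \<le> t * (v \<bullet> (G (x + t *\<^sub>R v) - G x))"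
      using mono[of "x + t *\<^sub>R v"] elim by (simp add: power2_eq_square algebra_simps)
    then show ?case using elim by (simp add: field_simps)
  qed
qed simp

lemma derivative_norm_le:
  fixes G :: "'a::real_normed_vector \<Rightarrow> 'b::real_inner"
  assumes H: "(G has_derivative H) (at x)"
    and lip: "\<And>y. norm (G y - G x) \<le> B * norm (y - x)"
  shows "norm (H v) \<le> B * norm v"
proof -
  have "H v \<bullet> H v \<le> norm (H v) * (B * norm v)"
  proof (rule tendsto_upperbound[OF directional_quotient[OF H]])
    show "\<forall>\<^sub>F t in at_right 0. H v \<bullet> (G (x + t *\<^sub>R v) - G x) / t \<le> norm (H v) * (B * norm v)"
      using eventually_at_right_less[of "0::real"]
    proof eventually_elim
      case (elim t)
      have "H v \<bullet> (G (x + t *\<^sub>R v) - G x) \<le> norm (H v) * norm (G (x + t *\<^sub>R v) - G x)"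
        by (rule norm_cauchy_schwarz)
      also have "\<dots> \<le> norm (H v) * (B * norm (t *\<^sub>R v))"
        using lip[of "x + t *\<^sub>R v"] by (intro mult_left_mono) auto
      finally show ?case using elim by (simp add: field_simps)
    qed
  qed simp
  then have "norm (H v) * norm (H v) \<le> norm (H v) * (B * norm v)"
    by (metis power2_norm_eq_inner power2_eq_square)
  moreover have "0 \<le> B * norm v" using order_trans[OF norm_ge_zero lip[of "x + v"]] by simp
  ultimately show ?thesis by (cases "H v = 0") (auto simp: mult_le_cancel_left)
qed

lemma jacobian_eqI:
  fixes h :: "real ^ 'a \<Rightarrow> real ^ 'b"
  assumes "(h has_derivative D) (at x)"
  shows "jacobian h (at x) *v v = D v"
  using has_derivative_unique[OF assms] jacobian_works[of h "at x"] assms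
  unfolding differentiable_def by metis

lemma has_derivative_snd_slice:
  assumes "(h has_derivative D) (at (x, y))"
  shows "((\<lambda>\<eta>. h (x, \<eta>)) has_derivative (\<lambda>v. D (0, v))) (at y)"
proof -
  have "((\<lambda>\<eta>. (x, \<eta>)) has_derivative (\<lambda>v. (0, v))) (at y)" by (auto intro!: derivative_eq_intros)
  then show ?thesis using assms by (rule has_derivative_compose)
qed

section \<open>Partial gradients of twice continuously differentiable functions\<close>

text \<open>The gradient in the first variable, as a function of both variables.\<close>

definition pgrad :: "((real ^ 'n) \<times> (real ^ 'r) \<Rightarrow> real) \<Rightarrow> (real ^ 'n) \<times> (real ^ 'r) \<Rightarrow> real ^ 'n" where
  "pgrad F z = gradient (\<lambda>x. F (x, snd z)) (fst z)"

text \<open>What the proof uses of twice continuous differentiability. The second fact holds near \<open>z\<close> and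
  not just on \<open>S\<close> because the derivative in the parameter that defines \<open>L_star\<close> also tests
  parameters near \<open>\<xi>\<close> that lie outside \<open>\<Xi>\<close>.\<close>

lemma C2_on_pgrad:
  fixes F :: "(real ^ 'n) \<times> (real ^ 'r) \<Rightarrow> real"
  assumes "C2_on S F" "z \<in> S"
  shows "F differentiable (at z)"
    and "\<forall>\<^sub>F w in nhds z. GDERIV (\<lambda>x. F (x, snd w)) (fst w) :> pgrad F w"
    and "pgrad F differentiable (at z)"
proof -
  from assms(1) obtain W and F' :: "(real ^ 'n) \<times> (real ^ 'r) \<Rightarrow> ((real ^ 'n) \<times> (real ^ 'r)) \<Rightarrow>\<^sub>L real" and F''
    where W: "open W" "S \<subseteq> W" and F': "\<And>z. z \<in> W \<Longrightarrow> (F has_derivative blinfun_apply (F' z)) (at z)"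
      and F'': "\<And>z. z \<in> W \<Longrightarrow> (F' has_derivative blinfun_apply (F'' z)) (at z)"
    unfolding C2_on_def by blast
  have z: "z \<in> W" using W assms(2) by blast
  show "F differentiable (at z)" using F'[OF z] by (auto simp: differentiable_def)
  define D where "D w = (\<Sum>b\<in>Basis. F' w (b, 0) *\<^sub>R b)" for w
  have GD: "GDERIV (\<lambda>x. F (x, snd w)) (fst w) :> D w" if "w \<in> W" for w
  proof -
    have "((\<lambda>x. (x, snd w)) has_derivative (\<lambda>v. (v, 0))) (at (fst w))"
      by (auto intro!: derivative_eq_intros)
    moreover have "(F has_derivative blinfun_apply (F' w)) (at (fst w, snd w))" using F'[OF that] by simp
    ultimately have d: "((\<lambda>x. F (x, snd w)) has_derivative (\<lambda>v. F' w (v, 0))) (at (fst w))"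
      by (rule has_derivative_compose)
    then have lin: "linear (\<lambda>v. F' w (v, 0))" by (rule has_derivative_linear)
    have "F' w (v, 0) = v \<bullet> D w" for v
    proof -
      have "F' w (v, 0) = F' w (\<Sum>b\<in>Basis. (v \<bullet> b) *\<^sub>R b, 0)" by (simp add: euclidean_representation)
      also have "\<dots> = (\<Sum>b\<in>Basis. (v \<bullet> b) *\<^sub>R F' w (b, 0))"
        using linear_sum[OF lin, of "\<lambda>b. (v \<bullet> b) *\<^sub>R b" Basis] by (simp add: linear_scale[OF lin])
      also have "\<dots> = v \<bullet> D w" by (simp add: D_def inner_sum_right mult.commute)
      finally show ?thesis .
    qed
    then show ?thesis using d by (simp add: gderiv_def)
  qed
  have D: "pgrad F w = D w" if "w \<in> W" for w
    unfolding pgrad_def using GD[OF that] by (rule gradient_eqI)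
  show "\<forall>\<^sub>F w in nhds z. GDERIV (\<lambda>x. F (x, snd w)) (fst w) :> pgrad F w"
    using W(1) z GD D by (auto simp: eventually_nhds)
  have "(\<lambda>w. F' w (b, 0)) differentiable (at z)" for b
    unfolding differentiable_def
    using bounded_linear.has_derivative[OF
      bounded_bilinear.bounded_linear_left[OF bounded_bilinear_blinfun_apply] F''[OF z]] by blast
  then have "D differentiable (at z)"
    unfolding D_def by (intro differentiable_sum differentiable_scaleR differentiable_const) auto
  then obtain D' where "(D has_derivative D') (at z)" by (auto simp: differentiable_def)
  then have "(pgrad F has_derivative D') (at z)"
    by (rule has_derivative_transform_within_open[OF _ W(1) z]) (simp add: D)
  then show "pgrad F differentiable (at z)" by (auto simp: differentiable_def)
qed

lemma C2_on_vec_nth: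
  fixes g :: "'a::real_normed_vector \<Rightarrow> real ^ 'm"
  assumes "C2_on S g"
  shows "C2_on S (\<lambda>z. g z $ i)"
proof -
  from assms obtain W and g' :: "'a \<Rightarrow> 'a \<Rightarrow>\<^sub>L (real ^ 'm)" and g'' 
    where W: "open W" "S \<subseteq> W" and g': "\<And>z. z \<in> W \<Longrightarrow> (g has_derivative blinfun_apply (g' z)) (at z)"
      and g'': "\<And>z. z \<in> W \<Longrightarrow> (g' has_derivative blinfun_apply (g'' z)) (at z)"
      and c: "continuous_on W g''"
    unfolding C2_on_def by blast
  define p where "p = Blinfun (\<lambda>v :: real ^ 'm. v $ i)"
  have p: "blinfun_apply p = (\<lambda>v. v $ i)"
    unfolding p_def by (rule bounded_linear_Blinfun_apply[OF bounded_linear_vec_nth])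
  define M where "M = Blinfun (\<lambda>A :: 'a \<Rightarrow>\<^sub>L (real ^ 'm). p o\<^sub>L A)"
  have bl: "bounded_linear (\<lambda>A :: 'a \<Rightarrow>\<^sub>L (real ^ 'm). p o\<^sub>L A)"
    by (rule bounded_bilinear.bounded_linear_right[OF bounded_bilinear_blinfun_compose])
  have M: "blinfun_apply M = (\<lambda>A. p o\<^sub>L A)"
    unfolding M_def by (rule bounded_linear_Blinfun_apply[OF bl])
  show ?thesis
    unfolding C2_on_def
  proof (intro exI conjI ballI)
    show "((\<lambda>z. g z $ i) has_derivative blinfun_apply (p o\<^sub>L g' z)) (at z)" if "z \<in> W" for z
      using bounded_linear.has_derivative[OF bounded_linear_vec_nth g'[OF that], of i]
      by (simp add: p blinfun_compose.rep_eq o_def)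
    show "((\<lambda>z. p o\<^sub>L g' z) has_derivative blinfun_apply (M o\<^sub>L g'' z)) (at z)" if "z \<in> W" for z
      using bounded_linear.has_derivative[OF bl g''[OF that]] by (simp add: M blinfun_compose.rep_eq o_def)
    show "continuous_on W (\<lambda>z. M o\<^sub>L g'' z)"
      by (intro continuous_intros c)
  qed (use W in auto)
qed

section \<open>From local to global Lipschitz bounds\<close>

text \<open>Along a segment, an interval bisection argument (\<open>Bolzano\<close>) reduces an estimate that is
  additive over subintervals to subintervals containing a given point and arbitrarily short,
  where the local bound at that point applies on either side of it.\<close>

lemma lipschitz_on_if_locally:
  fixes F :: "'a::real_normed_vector \<Rightarrow> 'b::metric_space"
  assumes S: "convex S" and C: "0 \<le> C"
    and local: "\<And>x C'. x \<in> S \<Longrightarrow> C < C' \<Longrightarrow> \<forall>\<^sub>F y in at x within S. dist (F y) (F x) \<le> C' * dist y x"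
  shows "C-lipschitz_on S F"
proof (rule lipschitz_onI[OF _ C])
  fix x y assume xy: "x \<in> S" "y \<in> S"
  define \<gamma> where "\<gamma> t = x + t *\<^sub>R (y - x)" for t
  let ?n = "norm (y - x)"
  have \<gamma>S: "\<gamma> t \<in> S" if "0 \<le> t" "t \<le> 1" for t
    using convexD_alt[OF S xy(1) xy(2) that] by (simp add: \<gamma>_def algebra_simps)
  have \<gamma>_dist: "dist (\<gamma> s) (\<gamma> t) = \<bar>s - t\<bar> * ?n" for s t
    by (simp add: \<gamma>_def dist_norm flip: scaleR_diff_left)
  have bound: "dist (F x) (F y) \<le> C' * ?n" if C': "C < C'" for C'
  proof -
    have "0 \<le> (0::real) \<longrightarrow> (1::real) \<le> 1 \<longrightarrow> dist (F (\<gamma> 0)) (F (\<gamma> 1)) \<le> C' * ((1 - 0) * ?n)"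
    proof (rule Bolzano[of 0 1 "\<lambda>a b. 0 \<le> a \<longrightarrow> b \<le> 1 \<longrightarrow> dist (F (\<gamma> a)) (F (\<gamma> b)) \<le> C' * ((b - a) * ?n)"])
      fix a b c :: real
      assume 1: "0 \<le> a \<longrightarrow> b \<le> 1 \<longrightarrow> dist (F (\<gamma> a)) (F (\<gamma> b)) \<le> C' * ((b - a) * ?n)"
        and 2: "0 \<le> b \<longrightarrow> c \<le> 1 \<longrightarrow> dist (F (\<gamma> b)) (F (\<gamma> c)) \<le> C' * ((c - b) * ?n)"
        and "a \<le> b" "b \<le> c"
      show "0 \<le> a \<longrightarrow> c \<le> 1 \<longrightarrow> dist (F (\<gamma> a)) (F (\<gamma> c)) \<le> C' * ((c - a) * ?n)"
      proof (intro impI)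
        assume "0 \<le> a" "c \<le> 1"
        then have "dist (F (\<gamma> a)) (F (\<gamma> c)) \<le> C' * ((b - a) * ?n) + C' * ((c - b) * ?n)"
          using 1 2 \<open>a \<le> b\<close> \<open>b \<le> c\<close> dist_triangle[of "F (\<gamma> a)" "F (\<gamma> c)" "F (\<gamma> b)"] by linarith
        then show "dist (F (\<gamma> a)) (F (\<gamma> c)) \<le> C' * ((c - a) * ?n)" by (simp add: algebra_simps)
      qed
    next
      fix t :: real assume t: "0 \<le> t" "t \<le> 1"
      from local[OF \<gamma>S[OF t] C'] obtain d where d: "0 < d"
        "\<And>z. z \<in> S \<Longrightarrow> z \<noteq> \<gamma> t \<Longrightarrow> dist z (\<gamma> t) < d \<Longrightarrow> dist (F z) (F (\<gamma> t)) \<le> C' * dist z (\<gamma> t)"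
        unfolding eventually_at by blast
      have near: "dist (F (\<gamma> s)) (F (\<gamma> t)) \<le> C' * (\<bar>s - t\<bar> * ?n)"
        if "0 \<le> s" "s \<le> 1" "\<bar>s - t\<bar> < d / (?n + 1)" for s
      proof (cases "\<gamma> s = \<gamma> t")
        case False
        have "\<bar>s - t\<bar> * ?n \<le> \<bar>s - t\<bar> * (?n + 1)" by (simp add: algebra_simps)
        also have "\<dots> < d" using that(3) by (simp add: pos_less_divide_eq add_nonneg_pos)
        finally show ?thesis using d(2)[OF \<gamma>S[OF that(1,2)] False] by (simp add: \<gamma>_dist)
      qed (use C C' in simp)
      show "\<exists>\<delta>>0. \<forall>a b. a \<le> t \<and> t \<le> b \<and> b - a < \<delta> \<longrightarrow>
          0 \<le> a \<longrightarrow> b \<le> 1 \<longrightarrow> dist (F (\<gamma> a)) (F (\<gamma> b)) \<le> C' * ((b - a) * ?n)"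
      proof (intro exI[of _ "d / (?n + 1)"] conjI allI impI)
        show "0 < d / (?n + 1)" using d(1) by (simp add: add_nonneg_pos)
        fix a b assume ab: "a \<le> t \<and> t \<le> b \<and> b - a < d / (?n + 1)" "0 \<le> a" "b \<le> 1"
        have "dist (F (\<gamma> a)) (F (\<gamma> t)) \<le> C' * ((t - a) * ?n)" using near[of a] ab t by simp
        moreover have "dist (F (\<gamma> b)) (F (\<gamma> t)) \<le> C' * ((b - t) * ?n)" using near[of b] ab t by simp
        ultimately have "dist (F (\<gamma> a)) (F (\<gamma> b)) \<le> C' * ((t - a) * ?n) + C' * ((b - t) * ?n)"
          using dist_triangle2[of "F (\<gamma> a)" "F (\<gamma> b)" "F (\<gamma> t)"] by linarith
        then show "dist (F (\<gamma> a)) (F (\<gamma> b)) \<le> C' * ((b - a) * ?n)" by (simp add: algebra_simps)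
      qed
    qed simp
    then show ?thesis by (simp add: \<gamma>_def)
  qed
  show "dist (F x) (F y) \<le> C * dist x y"
  proof (cases "x = y")
    case False
    then have n: "0 < ?n" by simp
    have "dist (F x) (F y) / ?n \<le> C"
      by (rule dense_ge) (use bound n in \<open>simp add: field_simps\<close>)
    then show ?thesis using n by (simp add: field_simps dist_norm norm_minus_commute)
  qed simp
qed

text \<open>The error terms of the linearisation are proportional to the increments \<open>X\<close> that are to be
  estimated. The value of \<open>\<eta>\<close> is the one for which moving \<open>\<eta> * c * X\<close> to the left-hand
  side gives exactly the factor \<open>S + \<epsilon>\<close>, since \<open>(S + \<epsilon>) (1 - \<eta> c) = S + \<eta>\<close>.\<close>

lemma absorb_small_terms:
  fixes X t S \<epsilon> c \<eta> :: real
  assumes "0 \<le> S" "0 < \<epsilon>" "0 \<le> c" and \<eta>: "\<eta> = \<epsilon> / (1 + (S + \<epsilon>) * c)"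
    and X: "X \<le> S * t + \<eta> * (t + c * X)"
  shows "X \<le> (S + \<epsilon>) * t"
proof -
  have "0 < 1 + (S + \<epsilon>) * c" using assms by (simp add: add_pos_nonneg)
  then have \<eta>0: "0 < \<eta>" and "\<eta> * (1 + (S + \<epsilon>) * c) = \<epsilon>"
    using assms(2) by (simp_all add: \<eta>)
  then have \<eta>1: "\<eta> + (S + \<epsilon>) * (\<eta> * c) = \<epsilon>" by (simp add: algebra_simps)
  have eq: "(S + \<epsilon>) * (1 - \<eta> * c) = S + \<eta>" using \<eta>1 by (simp add: algebra_simps)
  have "0 < S + \<eta>" using \<eta>0 assms by simp
  then have pos: "0 < 1 - \<eta> * c" using eq assms by (metis add_nonneg_pos zero_less_mult_pos)
  have "X * (1 - \<eta> * c) \<le> (S + \<eta>) * t" using X by (simp add: algebra_simps)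
  also have "\<dots> = ((S + \<epsilon>) * t) * (1 - \<eta> * c)" by (simp flip: eq)
  finally show ?thesis using pos by (rule mult_right_le_imp_le)
qed

lemma divide_le_powr_three_halves_divide:
  fixes \<alpha> b \<omega> :: real
  assumes "0 < \<alpha>" "\<alpha> \<le> b" "0 < \<omega>"
  shows "b / \<omega> \<le> b powr (3/2) / (\<alpha> powr (1/2) * \<omega>)"
proof -
  have "b * \<alpha> powr (1/2) \<le> b * b powr (1/2)"
    using assms by (intro mult_left_mono powr_mono2) auto
  also have "b * b powr (1/2) = b powr (3/2)" using assms powr_add[of b 1 "1/2"] by simp
  finally show ?thesis using assms by (simp add: field_simps)
qed

section \<open>Existence and uniqueness of primal and dual solutions\<close>

locale parametric_program =
  fixes \<Xi> :: "(real ^ 'r) set"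
    and f :: "(real ^ 'n) \<times> (real ^ 'r) \<Rightarrow> real"
    and g :: "(real ^ 'n) \<times> (real ^ 'r) \<Rightarrow> real ^ 'm"
    and \<alpha> \<beta> \<omega> :: real
    and l \<zeta> :: "'m \<Rightarrow> real"
  assumes f_C2: "C2_on (UNIV \<times> \<Xi>) f" and g_C2: "C2_on (UNIV \<times> \<Xi>) g"
    and feasible_nonempty: "\<And>\<xi>. \<xi> \<in> \<Xi> \<Longrightarrow> feasible g \<xi> \<noteq> {}"
    and f_strongly_convex: "\<And>\<xi>. \<xi> \<in> \<Xi> \<Longrightarrow> strongly_convex \<alpha> (\<lambda>x. f (x, \<xi>))"
    and f_lipschitz: "\<And>\<xi>. \<xi> \<in> \<Xi> \<Longrightarrow> \<beta>-lipschitz_on UNIV (gradient (\<lambda>x. f (x, \<xi>)))"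
    and g_convex: "\<And>\<xi> i. \<xi> \<in> \<Xi> \<Longrightarrow> convex_on UNIV (\<lambda>x. g (x, \<xi>) $ i)"
    and g_lipschitz: "\<And>\<xi> i. \<xi> \<in> \<Xi> \<Longrightarrow> (l i)-lipschitz_on UNIV (gradient (\<lambda>x. g (x, \<xi>) $ i))"
    and \<omega>_pos: "0 < \<omega>"
    and licq_matrix: "\<And>\<xi> x. \<xi> \<in> \<Xi> \<Longrightarrow> x \<in> feasible g \<xi> \<Longrightarrow> active_set g \<xi> x \<noteq> {} \<Longrightarrow>
           (let I = active_set g \<xi> x; J = rows_on I (jacobian (\<lambda>y. g (y, \<xi>)) (at x))
            in loewner_le (\<omega>\<^sup>2 *\<^sub>R mat_on I) (J ** transpose J))"
    and multiplier_bound: "\<And>\<xi> x \<mu> i. \<xi> \<in> \<Xi> \<Longrightarrow> kkt_point f g \<xi> x \<mu> \<Longrightarrow> \<mu> $ i \<le> \<zeta> i"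
begin

abbreviation Df :: "(real ^ 'n) \<times> (real ^ 'r) \<Rightarrow> real ^ 'n" where
  "Df \<equiv> pgrad f"

abbreviation Dg :: "'m \<Rightarrow> (real ^ 'n) \<times> (real ^ 'r) \<Rightarrow> real ^ 'n" where
  "Dg i \<equiv> pgrad (\<lambda>z. g z $ i)"

text \<open>The gradient of the Lagrangian in \<open>x\<close>.\<close>

definition grad_L :: "real ^ 'm \<Rightarrow> (real ^ 'n) \<times> (real ^ 'r) \<Rightarrow> real ^ 'n" where
  "grad_L \<mu> z = Df z + comb (\<lambda>i. Dg i z) \<mu>"

lemma \<alpha>_pos: "\<xi> \<in> \<Xi> \<Longrightarrow> 0 < \<alpha>"
  using f_strongly_convex by (auto simp: strongly_convex_def)

lemma gi_C2: "C2_on (UNIV \<times> \<Xi>) (\<lambda>z. g z $ i)"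
  by (rule C2_on_vec_nth[OF g_C2])

lemma f_gderiv: "\<xi> \<in> \<Xi> \<Longrightarrow> GDERIV (\<lambda>x. f (x, \<xi>)) x :> Df (x, \<xi>)"
  using eventually_nhds_x_imp_x[OF C2_on_pgrad(2)[OF f_C2, of "(x, \<xi>)"]] by simp

lemma g_gderiv: "\<xi> \<in> \<Xi> \<Longrightarrow> GDERIV (\<lambda>x. g (x, \<xi>) $ i) x :> Dg i (x, \<xi>)"
  using eventually_nhds_x_imp_x[OF C2_on_pgrad(2)[OF gi_C2, of "(x, \<xi>)"]] by simp

lemma gderiv_lagrangian:
  assumes "GDERIV (\<lambda>x. f (x, \<eta>)) y :> Df (y, \<eta>)" "\<And>i. GDERIV (\<lambda>x. g (x, \<eta>) $ i) y :> Dg i (y, \<eta>)"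
  shows "GDERIV (\<lambda>x. lagrangian f g x \<mu> \<eta>) y :> grad_L \<mu> (y, \<eta>)"
proof -
  have "((\<lambda>x. f (x, \<eta>) + (\<Sum>i\<in>UNIV. \<mu> $ i * g (x, \<eta>) $ i)) has_derivative
      (\<lambda>v. v \<bullet> Df (y, \<eta>) + (\<Sum>i\<in>UNIV. \<mu> $ i * (v \<bullet> Dg i (y, \<eta>))))) (at y)"
    using assms unfolding gderiv_def
    by (intro has_derivative_add has_derivative_sum has_derivative_mult_right) auto
  then show ?thesis
    by (simp add: gderiv_def grad_L_def lagrangian_def inner_vec_def[of \<mu>] inner_add_right inner_sum_right)
qed

lemma lagrangian_gderiv:
  "\<xi> \<in> \<Xi> \<Longrightarrow> GDERIV (\<lambda>x. lagrangian f g x \<mu> \<xi>) y :> grad_L \<mu> (y, \<xi>)"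
  using f_gderiv g_gderiv by (rule gderiv_lagrangian)

lemma kkt_point_iff:
  assumes "\<xi> \<in> \<Xi>"
  shows "kkt_point f g \<xi> x \<mu> \<longleftrightarrow>
    x \<in> feasible g \<xi> \<and> 0 \<le> \<mu> \<and> grad_L \<mu> (x, \<xi>) = 0 \<and> (\<forall>i. g (x, \<xi>) $ i < 0 \<longrightarrow> \<mu> $ i = 0)"
  unfolding kkt_point_def gradient_eqI[OF lagrangian_gderiv[OF assms]] ..

lemma lagrangian_gradient_bound:
  assumes \<xi>: "\<xi> \<in> \<Xi>" and \<mu>: "0 \<le> \<mu>"
  shows "lagrangian f g x \<mu> \<xi> + (y - x) \<bullet> grad_L \<mu> (x, \<xi>) + \<alpha> / 2 * (norm (y - x))\<^sup>2
    \<le> lagrangian f g y \<mu> \<xi>"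
proof -
  have "(\<Sum>i\<in>UNIV. \<mu> $ i * (g (x, \<xi>) $ i + (y - x) \<bullet> Dg i (x, \<xi>))) \<le> (\<Sum>i\<in>UNIV. \<mu> $ i * g (y, \<xi>) $ i)"
    using \<mu> convex_on_gradient_bound[OF g_convex[OF \<xi>] g_gderiv[OF \<xi>]]
    by (intro sum_mono mult_left_mono) (auto simp: less_eq_vec_def)
  moreover have "f (x, \<xi>) + (y - x) \<bullet> Df (x, \<xi>) + \<alpha> / 2 * (norm (y - x))\<^sup>2 \<le> f (y, \<xi>)"
    by (rule strongly_convex_gradient_bound[OF f_strongly_convex[OF \<xi>] f_gderiv[OF \<xi>]])
  ultimately show ?thesis
    by (simp add: lagrangian_def grad_L_def inner_vec_def[of \<mu>] inner_add_right inner_sum_right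
        distrib_left sum.distrib)
qed

lemma grad_L_monotone:
  assumes "\<xi> \<in> \<Xi>" "0 \<le> \<mu>"
  shows "\<alpha> * (norm (y - x))\<^sup>2 \<le> (y - x) \<bullet> (grad_L \<mu> (y, \<xi>) - grad_L \<mu> (x, \<xi>))"
  using lagrangian_gradient_bound[OF assms, of x y] lagrangian_gradient_bound[OF assms, of y x]
  by (simp add: inner_diff_left inner_diff_right norm_minus_commute field_simps)

lemma grad_L_lipschitz:
  assumes \<xi>: "\<xi> \<in> \<Xi>" and \<mu>: "0 \<le> \<mu>" "\<And>i. \<mu> $ i \<le> \<zeta> i"
  shows "norm (grad_L \<mu> (y, \<xi>) - grad_L \<mu> (x, \<xi>)) \<le> (\<beta> + (\<Sum>i\<in>UNIV. \<zeta> i * l i)) * norm (y - x)"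
proof -
  have "norm (Df (y, \<xi>) - Df (x, \<xi>)) \<le> \<beta> * norm (y - x)"
    using lipschitz_onD[OF f_lipschitz[OF \<xi>], of y x] by (simp add: dist_norm pgrad_def)
  moreover have "norm (\<mu> $ i *\<^sub>R (Dg i (y, \<xi>) - Dg i (x, \<xi>))) \<le> \<zeta> i * l i * norm (y - x)" for i
  proof -
    have "norm (Dg i (y, \<xi>) - Dg i (x, \<xi>)) \<le> l i * norm (y - x)"
      using lipschitz_onD[OF g_lipschitz[OF \<xi>], of y x i] by (simp add: dist_norm pgrad_def)
    then have "\<mu> $ i * norm (Dg i (y, \<xi>) - Dg i (x, \<xi>)) \<le> \<zeta> i * (l i * norm (y - x))"
      using \<mu> lipschitz_on_nonneg[OF g_lipschitz[OF \<xi>, of i]]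
      by (intro mult_mono) (auto simp: less_eq_vec_def order_trans[of 0 "\<mu> $ i" "\<zeta> i"])
    then show ?thesis using \<mu>(1) by (simp add: less_eq_vec_def mult.assoc)
  qed
  then have "norm (\<Sum>i\<in>UNIV. \<mu> $ i *\<^sub>R (Dg i (y, \<xi>) - Dg i (x, \<xi>))) \<le> (\<Sum>i\<in>UNIV. \<zeta> i * l i * norm (y - x))"
    by (rule sum_norm_le)
  ultimately have "norm (Df (y, \<xi>) - Df (x, \<xi>) + (\<Sum>i\<in>UNIV. \<mu> $ i *\<^sub>R (Dg i (y, \<xi>) - Dg i (x, \<xi>))))
      \<le> \<beta> * norm (y - x) + (\<Sum>i\<in>UNIV. \<zeta> i * l i * norm (y - x))"
    by (rule norm_triangle_mono)
  moreover have "Df (y, \<xi>) - Df (x, \<xi>) + (\<Sum>i\<in>UNIV. \<mu> $ i *\<^sub>R (Dg i (y, \<xi>) - Dg i (x, \<xi>)))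
      = grad_L \<mu> (y, \<xi>) - grad_L \<mu> (x, \<xi>)"
    by (simp add: grad_L_def scaleR_diff_right sum_subtractf)
  ultimately show ?thesis by (simp add: distrib_right sum_distrib_right)
qed

text \<open>The quadratic form of the Gram matrix of the active gradients at \<open>\<nu>\<close> is the squared norm of
  their combination with coefficients \<open>\<nu>\<close>, so the matrix inequality is the lower bound \<open>\<omega>\<close>
  in \<open>unif_indep\<close>. For an empty active set only \<open>\<nu> = 0\<close> has to be tested.\<close>

lemma licq:
  assumes \<xi>: "\<xi> \<in> \<Xi>" and x: "x \<in> feasible g \<xi>"
  shows "unif_indep \<omega> (active_set g \<xi> x) (\<lambda>i. Dg i (x, \<xi>))"
  unfolding unif_indep_def
proof (intro allI impI)
  fix \<nu> :: "real ^ 'm"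
  let ?I = "active_set g \<xi> x" and ?A = "jacobian (\<lambda>y. g (y, \<xi>)) (at x)"
  let ?J = "rows_on ?I ?A"
  assume off: "\<forall>i. i \<notin> ?I \<longrightarrow> \<nu> $ i = 0"
  show "\<omega> * norm \<nu> \<le> norm (comb (\<lambda>i. Dg i (x, \<xi>)) \<nu>)"
  proof (cases "?I = {}")
    case True
    then have "\<nu> = 0" using off by (simp add: vec_eq_iff)
    then show ?thesis by simp
  next
    case False
    have "((\<lambda>y. g (y, \<xi>)) has_derivative (\<lambda>h. \<chi> i. h \<bullet> Dg i (x, \<xi>))) (at x)"
      using g_gderiv[OF \<xi>, of _ x] unfolding gderiv_def
      by (subst has_derivative_componentwise_within) (auto simp: Basis_vec_def inner_axis)
    moreover from this have "((\<lambda>y. g (y, \<xi>)) has_derivative (\<lambda>h. ?A *v h)) (at x)"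
      using jacobian_works differentiable_def by blast
    ultimately have J0: "?A *v h = (\<chi> i. h \<bullet> Dg i (x, \<xi>))" for h
      using has_derivative_unique by metis
    have "h \<bullet> row i ?A = h \<bullet> Dg i (x, \<xi>)" for h i
      using arg_cong[OF J0[of h], of "\<lambda>v. v $ i"] by (simp add: matrix_vector_mul_component row_def inner_commute)
    then have row: "row i ?A = Dg i (x, \<xi>)" for i by (metis vector_eq_ldot)
    have "transpose ?J *v \<nu> = (\<Sum>i\<in>UNIV. \<nu> $ i *\<^sub>R row i ?J)"
      by (simp add: matrix_mult_sum scalar_mult_eq_scaleR)
    also have "\<dots> = comb (\<lambda>i. Dg i (x, \<xi>)) \<nu>"
    proof (rule sum.cong[OF refl])
      fix i
      have "row i ?J = (if i \<in> ?I then Dg i (x, \<xi>) else 0)"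
        by (simp add: rows_on_def row_def[of i "\<chi> i. _ i"] row vec_nth_inverse)
      then show "\<nu> $ i *\<^sub>R row i ?J = \<nu> $ i *\<^sub>R Dg i (x, \<xi>)" using off by simp
    qed
    finally have JT: "transpose ?J *v \<nu> = comb (\<lambda>i. Dg i (x, \<xi>)) \<nu>" .
    have "(mat_on ?I *v \<nu>) $ i = (\<Sum>j\<in>UNIV. if j = i then \<nu> $ i else 0)" for i
      unfolding mat_on_def matrix_vector_mult_def vec_lambda_beta
      by (rule sum.cong) (use off in auto)
    then have "mat_on ?I *v \<nu> = \<nu>" by (simp add: vec_eq_iff)
    then have "(\<omega>\<^sup>2 *\<^sub>R mat_on ?I) *v \<nu> = \<omega>\<^sup>2 *\<^sub>R \<nu>" by (simp flip: scaleR_matrix_vector_assoc)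
    moreover have "0 \<le> \<nu> \<bullet> ((?J ** transpose ?J - \<omega>\<^sup>2 *\<^sub>R mat_on ?I) *v \<nu>)"
      using licq_matrix[OF \<xi> x False] by (simp add: Let_def loewner_le_def pos_semidef_def)
    moreover have "\<nu> \<bullet> ((?J ** transpose ?J) *v \<nu>) = (transpose ?J *v \<nu>) \<bullet> (transpose ?J *v \<nu>)"
      by (simp only: matrix_vector_mul_assoc[symmetric] dot_lmul_matrix[symmetric] transpose_matrix_vector)
    ultimately have "\<omega>\<^sup>2 * (\<nu> \<bullet> \<nu>) \<le> (transpose ?J *v \<nu>) \<bullet> (transpose ?J *v \<nu>)"
      unfolding matrix_vector_mult_diff_rdistrib inner_diff_right by simp
    then have "(\<omega> * norm \<nu>)\<^sup>2 \<le> (norm (comb (\<lambda>i. Dg i (x, \<xi>)) \<nu>))\<^sup>2"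
      unfolding JT power_mult_distrib power2_norm_eq_inner .
    then show ?thesis by (rule power2_le_imp_le) simp
  qed
qed

lemma continuous_at_g: "\<xi> \<in> \<Xi> \<Longrightarrow> isCont g (x, \<xi>)"
proof -
  assume "\<xi> \<in> \<Xi>"
  then have "(x, \<xi>) \<in> UNIV \<times> \<Xi>" by simp
  then show ?thesis
    using g_C2 has_derivative_continuous unfolding C2_on_def by blast
qed

lemma feasible_iff: "x \<in> feasible g \<xi> \<longleftrightarrow> (\<forall>i. g (x, \<xi>) $ i \<le> 0)"
  by (simp add: feasible_def less_eq_vec_def)

lemma isCont_g_fst: "\<xi> \<in> \<Xi> \<Longrightarrow> isCont (\<lambda>x. g (x, \<xi>) $ i) x"
  using g_gderiv[of \<xi> i x] has_derivative_continuous unfolding gderiv_def by blast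

lemma ex1_primal_solution:
  assumes \<xi>: "\<xi> \<in> \<Xi>"
  shows "\<exists>!x. x \<in> primal_solutions f g \<xi>"
proof -
  have eq: "feasible g \<xi> = (\<Inter>i. {x. g (x, \<xi>) $ i \<le> 0})" by (auto simp: feasible_iff)
  have "closed (feasible g \<xi>)"
    unfolding eq using isCont_g_fst[OF \<xi>]
    by (intro closed_INT ballI closed_Collect_le continuous_at_imp_continuous_on) auto
  moreover have "convex {x. g (x, \<xi>) $ i \<le> 0}" for i
  proof (rule convexI, unfold mem_Collect_eq)
    fix x y :: "real ^ 'n" and u v :: real
    assume xy: "g (x, \<xi>) $ i \<le> 0" "g (y, \<xi>) $ i \<le> 0" and uv: "0 \<le> u" "0 \<le> v" "u + v = 1"
    then have "g (u *\<^sub>R x + v *\<^sub>R y, \<xi>) $ i \<le> u * g (x, \<xi>) $ i + v * g (y, \<xi>) $ i"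
      using g_convex[OF \<xi>, of i] by (simp add: convex_on_def)
    also have "\<dots> \<le> 0" using xy uv by (intro add_nonpos_nonpos mult_nonneg_nonpos)
    finally show "g (u *\<^sub>R x + v *\<^sub>R y, \<xi>) $ i \<le> 0" .
  qed
  then have "convex (feasible g \<xi>)" unfolding eq by (intro convex_INT) auto
  ultimately show ?thesis
    using strongly_convex_unique_minimizer[OF f_strongly_convex[OF \<xi>] f_gderiv[OF \<xi>]]
      feasible_nonempty[OF \<xi>] by (simp add: primal_solutions_def)
qed

abbreviation "xs \<equiv> x_star f g"
abbreviation "ms \<equiv> mu_star f g"

lemma x_star_primal: "\<xi> \<in> \<Xi> \<Longrightarrow> xs \<xi> \<in> primal_solutions f g \<xi>"
  unfolding x_star_def by (rule theI'[OF ex1_primal_solution])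

lemma dual_solutions_eq: "\<xi> \<in> \<Xi> \<Longrightarrow> dual_solutions f g \<xi> = {\<mu>. kkt_point f g \<xi> (xs \<xi>) \<mu>}"
  using x_star_primal ex1_primal_solution unfolding dual_solutions_def by blast

text \<open>A direction that strictly decreases all active constraints stays feasible for a short time,
  so it cannot decrease the objective to first order; \<open>multipliers_exist\<close> turns this into
  multipliers.\<close>

lemma kkt_multiplier_exists:
  assumes \<xi>: "\<xi> \<in> \<Xi>" and x: "x \<in> primal_solutions f g \<xi>"
  shows "\<exists>\<mu>. kkt_point f g \<xi> x \<mu>"
proof -
  have xf: "x \<in> feasible g \<xi>" and opt: "\<And>y. y \<in> feasible g \<xi> \<Longrightarrow> f (x, \<xi>) \<le> f (y, \<xi>)"
    using x by (auto simp: primal_solutions_def)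
  have "0 \<le> Df (x, \<xi>) \<bullet> d" if d: "\<And>i. i \<in> active_set g \<xi> x \<Longrightarrow> Dg i (x, \<xi>) \<bullet> d < 0" for d
  proof -
    have "\<forall>\<^sub>F t in at_right 0. g (x + t *\<^sub>R d, \<xi>) $ i \<le> 0" for i
    proof (cases "i \<in> active_set g \<xi> x")
      case True
      have "((\<lambda>t. 1 \<bullet> (g (x + t *\<^sub>R d, \<xi>) $ i - g (x, \<xi>) $ i) / t) \<longlongrightarrow> 1 \<bullet> (d \<bullet> Dg i (x, \<xi>))) (at_right 0)"
        using g_gderiv[OF \<xi>, of i x] unfolding gderiv_def by (rule directional_quotient)
      then have "\<forall>\<^sub>F t in at_right 0. 1 \<bullet> (g (x + t *\<^sub>R d, \<xi>) $ i - g (x, \<xi>) $ i) / t < 0"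
        using d[OF True] by (intro order_tendstoD(2)) (auto simp: inner_commute)
      with eventually_at_right_less[of "0::real"] show ?thesis
      proof eventually_elim
        case (elim t)
        then show ?case using True by (simp add: active_set_def divide_less_0_iff)
      qed
    next
      case False
      then have "g (x, \<xi>) $ i < 0" using xf by (auto simp: active_set_def feasible_iff less_le)
      moreover have "((\<lambda>t. g (x + t *\<^sub>R d, \<xi>) $ i) \<longlongrightarrow> g (x, \<xi>) $ i) (at_right 0)"
        by (rule isCont_tendsto_compose[OF isCont_g_fst[OF \<xi>]]) (auto intro!: tendsto_eq_intros)
      ultimately have "\<forall>\<^sub>F t in at_right 0. g (x + t *\<^sub>R d, \<xi>) $ i < 0" by (intro order_tendstoD(2))
      then show ?thesis by eventually_elim simp
    qed
    then have "\<forall>\<^sub>F t in at_right 0. \<forall>i. g (x + t *\<^sub>R d, \<xi>) $ i \<le> 0"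
      by (rule eventually_all_finite)
    with eventually_at_right_less[of "0::real"]
    have "\<forall>\<^sub>F t in at_right 0. 0 \<le> 1 \<bullet> (f (x + t *\<^sub>R d, \<xi>) - f (x, \<xi>)) / t"
    proof eventually_elim
      case (elim t)
      then show ?case using opt[of "x + t *\<^sub>R d"] by (simp add: feasible_iff)
    qed
    moreover have "((\<lambda>t. 1 \<bullet> (f (x + t *\<^sub>R d, \<xi>) - f (x, \<xi>)) / t) \<longlongrightarrow> 1 \<bullet> (d \<bullet> Df (x, \<xi>))) (at_right 0)"
      using f_gderiv[OF \<xi>, of x] unfolding gderiv_def by (rule directional_quotient)
    ultimately have "0 \<le> 1 \<bullet> (d \<bullet> Df (x, \<xi>))"
      by (intro tendsto_lowerbound[OF _ _ trivial_limit_at_right_real])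
    then show ?thesis by (simp add: inner_commute)
  qed
  then obtain \<mu> where "0 \<le> \<mu>" "\<And>i. i \<notin> active_set g \<xi> x \<Longrightarrow> \<mu> $ i = 0"
      "Df (x, \<xi>) + comb (\<lambda>i. Dg i (x, \<xi>)) \<mu> = 0"
    using multipliers_exist[OF licq[OF \<xi> xf] \<omega>_pos] by blast
  then have "kkt_point f g \<xi> x \<mu>"
    using xf by (auto simp: kkt_point_iff[OF \<xi>] grad_L_def active_set_def)
  then show ?thesis by blast
qed

lemma active_multiplier:
  assumes "\<xi> \<in> \<Xi>" "kkt_point f g \<xi> x \<mu>" "\<mu> $ i \<noteq> 0"
  shows "g (x, \<xi>) $ i = 0"
  using assms unfolding kkt_point_iff[OF assms(1)] feasible_iff by (metis order.order_iff_strict)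

lemma ex1_dual_solution:
  assumes \<xi>: "\<xi> \<in> \<Xi>"
  shows "\<exists>!\<mu>. \<mu> \<in> dual_solutions f g \<xi>"
proof -
  have "\<mu> = \<mu>'" if k: "kkt_point f g \<xi> (xs \<xi>) \<mu>" and k': "kkt_point f g \<xi> (xs \<xi>) \<mu>'" for \<mu> \<mu>'
  proof -
    have "unif_indep \<omega> (active_set g \<xi> (xs \<xi>)) (\<lambda>i. Dg i (xs \<xi>, \<xi>))"
      using k by (intro licq \<xi>) (simp add: kkt_point_iff[OF \<xi>])
    moreover have "(\<mu> - \<mu>') $ i = 0" if "i \<notin> active_set g \<xi> (xs \<xi>)" for i
    proof -
      have "g (xs \<xi>, \<xi>) $ i \<noteq> 0" using that by (simp add: active_set_def)
      then have "\<mu> $ i = 0" "\<mu>' $ i = 0"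
        using active_multiplier[OF \<xi> k] active_multiplier[OF \<xi> k'] by blast+
      then show ?thesis by simp
    qed
    ultimately have "\<omega> * norm (\<mu> - \<mu>') \<le> norm (comb (\<lambda>i. Dg i (xs \<xi>, \<xi>)) (\<mu> - \<mu>'))"
      unfolding unif_indep_def by blast
    also have "comb (\<lambda>i. Dg i (xs \<xi>, \<xi>)) (\<mu> - \<mu>') = grad_L \<mu> (xs \<xi>, \<xi>) - grad_L \<mu>' (xs \<xi>, \<xi>)"
      by (simp add: grad_L_def scaleR_diff_left sum_subtractf)
    also have "\<dots> = 0" using k k' by (simp add: kkt_point_iff[OF \<xi>])
    finally show ?thesis using \<omega>_pos by (simp add: mult_le_0_iff)
  qed
  then show ?thesis
    using kkt_multiplier_exists[OF \<xi> x_star_primal[OF \<xi>]] unfolding dual_solutions_eq[OF \<xi>] by blast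
qed

lemma mu_star_kkt: "\<xi> \<in> \<Xi> \<Longrightarrow> kkt_point f g \<xi> (xs \<xi>) (ms \<xi>)"
  using theI'[OF ex1_dual_solution, of \<xi>] dual_solutions_eq[of \<xi>] unfolding mu_star_def by blast

section \<open>Continuity of the solution maps\<close>

lemma multiplier_inner_constraint_nonpos:
  assumes "x \<in> feasible g \<xi>" "0 \<le> \<mu>"
  shows "\<mu> \<bullet> g (x, \<xi>) \<le> 0"
  using assms unfolding inner_vec_def feasible_iff
  by (intro sum_nonpos) (auto simp: less_eq_vec_def mult_nonneg_nonpos)

lemma kkt_complementarity:
  assumes "\<xi> \<in> \<Xi>" "kkt_point f g \<xi> x \<mu>"
  shows "\<mu> \<bullet> g (x, \<xi>) = 0"
  unfolding inner_vec_def using active_multiplier[OF assms] by (intro sum.neutral) fastforce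

text \<open>Write \<open>x, \<mu>\<close> and \<open>x\<^sub>0, \<mu>\<^sub>0\<close> for the solutions at \<open>\<xi>\<close> and \<open>\<xi>\<^sub>0\<close>. All Lagrangians are taken at
  \<open>\<xi>\<close>. With multiplier \<open>\<mu>\<close> the value at \<open>x\<^sub>0\<close> exceeds the minimum, attained at \<open>x\<close>, by at least
  \<open>\<alpha> / 2 \<bar>x - x\<^sub>0\<bar>\<^sup>2\<close>; with multiplier \<open>\<mu>\<^sub>0\<close> the value at \<open>x\<close> exceeds the linearisation at \<open>x\<^sub>0\<close>
  by at least the same amount. In the sum of the two there remain the increment of \<open>g (x\<^sub>0, \<cdot>)\<close>,
  paired with \<open>\<mu> - \<mu>\<^sub>0\<close>, and the gradient at \<open>x\<^sub>0\<close> with multiplier \<open>\<mu>\<^sub>0\<close>, paired with \<open>x - x\<^sub>0\<close>;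
  both the increment and the gradient vanish for \<open>\<xi> = \<xi>\<^sub>0\<close>, and \<open>\<zeta>\<close> bounds \<open>\<mu> - \<mu>\<^sub>0\<close>.\<close>

lemma x_star_increment:
  assumes \<xi>0: "\<xi>0 \<in> \<Xi>" and \<xi>: "\<xi> \<in> \<Xi>"
  shows "\<alpha> * (norm (xs \<xi> - xs \<xi>0))\<^sup>2 \<le>
    norm (\<chi> i. \<zeta> i) * norm (g (xs \<xi>0, \<xi>) - g (xs \<xi>0, \<xi>0))
    + norm (grad_L (ms \<xi>0) (xs \<xi>0, \<xi>)) * norm (xs \<xi> - xs \<xi>0)"
proof -
  note k0 = mu_star_kkt[OF \<xi>0] and k = mu_star_kkt[OF \<xi>]
  let ?y = "xs \<xi>0" and ?x = "xs \<xi>" and ?\<kappa> = "ms \<xi>0" and ?\<mu> = "ms \<xi>"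
  have pos: "0 \<le> ?\<kappa>" "0 \<le> ?\<mu>" and feas: "?y \<in> feasible g \<xi>0" "?x \<in> feasible g \<xi>"
    using k0 k by (simp_all add: kkt_point_def)
  have "lagrangian f g ?x ?\<mu> \<xi> + \<alpha> / 2 * (norm (?x - ?y))\<^sup>2 \<le> lagrangian f g ?y ?\<mu> \<xi>"
    using lagrangian_gradient_bound[OF \<xi> pos(2), of ?x ?y] k
    by (simp add: kkt_point_iff[OF \<xi>] norm_minus_commute)
  moreover have "lagrangian f g ?y ?\<kappa> \<xi> + (?x - ?y) \<bullet> grad_L ?\<kappa> (?y, \<xi>)
      + \<alpha> / 2 * (norm (?x - ?y))\<^sup>2 \<le> lagrangian f g ?x ?\<kappa> \<xi>"
    by (rule lagrangian_gradient_bound[OF \<xi> pos(1)])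
  moreover have "lagrangian f g ?x ?\<kappa> \<xi> \<le> lagrangian f g ?x ?\<mu> \<xi>"
    using multiplier_inner_constraint_nonpos[OF feas(2) pos(1)] kkt_complementarity[OF \<xi> k]
    by (simp add: lagrangian_def)
  moreover have "(?\<mu> - ?\<kappa>) \<bullet> g (?y, \<xi>) \<le> (?\<mu> - ?\<kappa>) \<bullet> (g (?y, \<xi>) - g (?y, \<xi>0))"
    using multiplier_inner_constraint_nonpos[OF feas(1) pos(2)] kkt_complementarity[OF \<xi>0 k0]
    by (simp add: inner_diff_left inner_diff_right)
  moreover have "(?\<mu> - ?\<kappa>) \<bullet> (g (?y, \<xi>) - g (?y, \<xi>0))
      \<le> norm (\<chi> i. \<zeta> i) * norm (g (?y, \<xi>) - g (?y, \<xi>0))"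
  proof (rule order_trans[OF norm_cauchy_schwarz mult_right_mono])
    have "\<bar>(?\<mu> - ?\<kappa>) $ i\<bar> \<le> \<bar>\<zeta> i\<bar>" for i
      using pos multiplier_bound[OF \<xi> k, of i] multiplier_bound[OF \<xi>0 k0, of i]
      by (auto simp: less_eq_vec_def abs_le_iff intro: order_trans)
         (smt (verit))+
    then show "norm (?\<mu> - ?\<kappa>) \<le> norm (\<chi> i. \<zeta> i)" by (intro norm_le_componentwise_cart) simp
  qed simp
  moreover have "- ((?x - ?y) \<bullet> grad_L ?\<kappa> (?y, \<xi>)) \<le> norm (grad_L ?\<kappa> (?y, \<xi>)) * norm (?x - ?y)"
    using norm_cauchy_schwarz[of "?y - ?x" "grad_L ?\<kappa> (?y, \<xi>)"]
    by (simp add: inner_diff_left norm_minus_commute mult.commute)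
  ultimately show ?thesis by (simp add: lagrangian_def inner_diff_left)
qed

lemma Df_differentiable: "\<xi> \<in> \<Xi> \<Longrightarrow> Df differentiable (at (x, \<xi>))"
  by (rule C2_on_pgrad(3)[OF f_C2]) simp

lemma Dg_differentiable: "\<xi> \<in> \<Xi> \<Longrightarrow> Dg i differentiable (at (x, \<xi>))"
  by (rule C2_on_pgrad(3)[OF gi_C2]) simp

lemma grad_L_differentiable: "\<xi> \<in> \<Xi> \<Longrightarrow> grad_L \<mu> differentiable (at (x, \<xi>))"
  unfolding grad_L_def using Df_differentiable Dg_differentiable
  by (intro differentiable_add differentiable_sum differentiable_scaleR differentiable_const) auto

lemma isCont_grad_L: "\<xi> \<in> \<Xi> \<Longrightarrow> isCont (grad_L \<mu>) (x, \<xi>)"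
  using grad_L_differentiable differentiable_imp_continuous_within by blast

lemma x_star_tendsto:
  assumes \<xi>0: "\<xi>0 \<in> \<Xi>"
  shows "(xs \<longlongrightarrow> xs \<xi>0) (at \<xi>0 within \<Xi>)"
proof -
  let ?y = "xs \<xi>0"
  define A where "A \<xi> = norm (\<chi> i. \<zeta> i) * norm (g (?y, \<xi>) - g (?y, \<xi>0))" for \<xi>
  define \<delta> where "\<delta> \<xi> = norm (grad_L (ms \<xi>0) (?y, \<xi>))" for \<xi>
  have \<alpha>: "0 < \<alpha>" by (rule \<alpha>_pos[OF \<xi>0])
  \<comment> \<open>Solving \<open>\<alpha> e\<^sup>2 \<le> A + \<delta> e\<close> for \<open>e\<close>.\<close>
  have bound: "norm (xs \<xi> - ?y) \<le> \<delta> \<xi> / \<alpha> + sqrt (A \<xi> / \<alpha>)" if "\<xi> \<in> \<Xi>" for \<xi>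
  proof (cases "norm (xs \<xi> - ?y) \<le> \<delta> \<xi> / \<alpha>")
    case True
    then show ?thesis using \<alpha> by (simp add: add_increasing2 A_def)
  next
    case False
    let ?e = "norm (xs \<xi> - ?y)"
    have "\<alpha> * ?e\<^sup>2 \<le> A \<xi> + \<delta> \<xi> * ?e" using x_star_increment[OF \<xi>0 that] by (simp add: A_def \<delta>_def)
    moreover have "\<alpha> * ((?e - \<delta> \<xi> / \<alpha>) * ?e) = \<alpha> * ?e\<^sup>2 - \<delta> \<xi> * ?e"
      using \<alpha> by (simp add: algebra_simps power2_eq_square)
    ultimately have "\<alpha> * ((?e - \<delta> \<xi> / \<alpha>) * ?e) \<le> A \<xi>" by linarith
    then have "(?e - \<delta> \<xi> / \<alpha>) * ?e \<le> A \<xi> / \<alpha>"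
      using \<alpha> by (simp add: pos_le_divide_eq mult.commute)
    moreover have "(?e - \<delta> \<xi> / \<alpha>)\<^sup>2 \<le> (?e - \<delta> \<xi> / \<alpha>) * ?e"
      unfolding power2_eq_square using False \<alpha> by (intro mult_left_mono) (auto simp: \<delta>_def)
    ultimately have "?e - \<delta> \<xi> / \<alpha> \<le> sqrt (A \<xi> / \<alpha>)" by (intro real_le_rsqrt) simp
    then show ?thesis by simp
  qed
  have pair: "((\<lambda>\<xi>. (?y, \<xi>)) \<longlongrightarrow> (?y, \<xi>0)) (at \<xi>0 within \<Xi>)" by (intro tendsto_intros)
  have "((\<lambda>\<xi>. g (?y, \<xi>)) \<longlongrightarrow> g (?y, \<xi>0)) (at \<xi>0 within \<Xi>)"
    by (rule isCont_tendsto_compose[OF continuous_at_g[OF \<xi>0] pair])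
  moreover have "((\<lambda>\<xi>. grad_L (ms \<xi>0) (?y, \<xi>)) \<longlongrightarrow> grad_L (ms \<xi>0) (?y, \<xi>0)) (at \<xi>0 within \<Xi>)"
    by (rule isCont_tendsto_compose[OF isCont_grad_L[OF \<xi>0] pair])
  ultimately have "((\<lambda>\<xi>. \<delta> \<xi> / \<alpha> + sqrt (A \<xi> / \<alpha>)) \<longlongrightarrow>
      norm (grad_L (ms \<xi>0) (?y, \<xi>0)) / \<alpha>
      + sqrt (norm (\<chi> i. \<zeta> i) * norm (g (?y, \<xi>0) - g (?y, \<xi>0)) / \<alpha>)) (at \<xi>0 within \<Xi>)"
    unfolding A_def \<delta>_def using \<alpha> by (intro tendsto_intros) auto
  also have "norm (grad_L (ms \<xi>0) (?y, \<xi>0)) / \<alpha>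
      + sqrt (norm (\<chi> i. \<zeta> i) * norm (g (?y, \<xi>0) - g (?y, \<xi>0)) / \<alpha>) = 0"
    using mu_star_kkt[OF \<xi>0] by (simp add: kkt_point_iff[OF \<xi>0])
  finally have "((\<lambda>\<xi>. xs \<xi> - ?y) \<longlongrightarrow> 0) (at \<xi>0 within \<Xi>)"
    by (rule Lim_null_comparison[rotated]) (use bound in \<open>auto simp: eventually_at_filter\<close>)
  then show ?thesis by (simp add: Lim_null[symmetric])
qed

lemma graph_tendsto:
  "\<xi>0 \<in> \<Xi> \<Longrightarrow> ((\<lambda>\<xi>. (xs \<xi>, \<xi>)) \<longlongrightarrow> (xs \<xi>0, \<xi>0)) (at \<xi>0 within \<Xi>)"
  by (intro tendsto_Pair x_star_tendsto tendsto_ident_at)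

text \<open>Constraints that are slack at the solution for \<open>\<xi>0\<close> stay slack, so nearby active sets
  can only shrink.\<close>

lemma eventually_active_subset:
  assumes \<xi>0: "\<xi>0 \<in> \<Xi>"
  shows "\<forall>\<^sub>F \<xi> in at \<xi>0 within \<Xi>. active_set g \<xi> (xs \<xi>) \<subseteq> active_set g \<xi>0 (xs \<xi>0)"
proof -
  have "\<forall>\<^sub>F \<xi> in at \<xi>0 within \<Xi>. g (xs \<xi>, \<xi>) $ i = 0 \<longrightarrow> g (xs \<xi>0, \<xi>0) $ i = 0" for i
  proof (cases "g (xs \<xi>0, \<xi>0) $ i = 0")
    case False
    have "((\<lambda>\<xi>. g (xs \<xi>, \<xi>) $ i) \<longlongrightarrow> g (xs \<xi>0, \<xi>0) $ i) (at \<xi>0 within \<Xi>)"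
      by (intro tendsto_vec_nth isCont_tendsto_compose[OF continuous_at_g[OF \<xi>0] graph_tendsto[OF \<xi>0]])
    from tendsto_imp_eventually_ne[OF this False] show ?thesis by eventually_elim simp
  qed simp
  then have "\<forall>\<^sub>F \<xi> in at \<xi>0 within \<Xi>. \<forall>i. g (xs \<xi>, \<xi>) $ i = 0 \<longrightarrow> g (xs \<xi>0, \<xi>0) $ i = 0"
    by (rule eventually_all_finite)
  then show ?thesis by eventually_elim (auto simp: active_set_def)
qed

text \<open>Near \<open>\<xi>0\<close> the increment of the multipliers is supported on the active set at \<open>\<xi>0\<close>, where
  the gradients at \<open>\<xi>0\<close> are uniformly independent. Subtracting the two stationarity conditions expresses
  its image by increments of the gradients of \<open>f\<close> and \<open>g\<close>, with coefficients bounded by \<open>\<zeta>\<close>.\<close>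

lemma mu_star_tendsto:
  assumes \<xi>0: "\<xi>0 \<in> \<Xi>"
  shows "(ms \<longlongrightarrow> ms \<xi>0) (at \<xi>0 within \<Xi>)"
proof -
  let ?p = "(xs \<xi>0, \<xi>0)"
  define \<rho> where "\<rho> z = norm (Df z - Df ?p) + (\<Sum>i\<in>UNIV. \<zeta> i * norm (Dg i z - Dg i ?p))" for z
  note k0 = mu_star_kkt[OF \<xi>0]
  have ind: "unif_indep \<omega> (active_set g \<xi>0 (xs \<xi>0)) (\<lambda>i. Dg i ?p)"
    using k0 by (intro licq \<xi>0) (simp add: kkt_point_def)
  have bound: "\<omega> * norm (ms \<xi> - ms \<xi>0) \<le> \<rho> (xs \<xi>, \<xi>)"
    if \<xi>: "\<xi> \<in> \<Xi>" and sub: "active_set g \<xi> (xs \<xi>) \<subseteq> active_set g \<xi>0 (xs \<xi>0)" for \<xi>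
  proof -
    note k = mu_star_kkt[OF \<xi>]
    let ?z = "(xs \<xi>, \<xi>)"
    have "(ms \<xi> - ms \<xi>0) $ i = 0" if "i \<notin> active_set g \<xi>0 (xs \<xi>0)" for i
    proof -
      have "ms \<xi> $ i = 0" "ms \<xi>0 $ i = 0"
        using that sub active_multiplier[OF \<xi>0 k0] active_multiplier[OF \<xi> k]
        unfolding active_set_def by blast+
      then show ?thesis by simp
    qed
    then have "\<omega> * norm (ms \<xi> - ms \<xi>0) \<le> norm (comb (\<lambda>i. Dg i ?p) (ms \<xi> - ms \<xi>0))"
      using ind unfolding unif_indep_def by blast
    also have "comb (\<lambda>i. Dg i ?p) (ms \<xi> - ms \<xi>0) = grad_L (ms \<xi>) ?z - grad_L (ms \<xi>0) ?p
        - ((Df ?z - Df ?p) + comb (\<lambda>i. Dg i ?z - Dg i ?p) (ms \<xi>))"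
      by (simp add: grad_L_def scaleR_diff_left scaleR_diff_right sum_subtractf)
    also have "\<dots> = - ((Df ?z - Df ?p) + comb (\<lambda>i. Dg i ?z - Dg i ?p) (ms \<xi>))"
      using k k0 by (simp add: kkt_point_iff[OF \<xi>] kkt_point_iff[OF \<xi>0])
    also have "norm (- ((Df ?z - Df ?p) + comb (\<lambda>i. Dg i ?z - Dg i ?p) (ms \<xi>))) \<le> \<rho> ?z"
    proof -
      have "norm (ms \<xi> $ i *\<^sub>R (Dg i ?z - Dg i ?p)) \<le> \<zeta> i * norm (Dg i ?z - Dg i ?p)" for i
        using k multiplier_bound[OF \<xi> k, of i]
        by (auto simp: kkt_point_def less_eq_vec_def intro: mult_right_mono)
      then have "norm (comb (\<lambda>i. Dg i ?z - Dg i ?p) (ms \<xi>)) \<le> (\<Sum>i\<in>UNIV. \<zeta> i * norm (Dg i ?z - Dg i ?p))"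
        by (rule sum_norm_le)
      then show ?thesis
        unfolding \<rho>_def norm_minus_cancel by (rule norm_triangle_mono[OF order_refl])
    qed
    finally show ?thesis .
  qed
  have Df: "isCont Df ?p" and Dg: "isCont (Dg i) ?p" for i
    using Df_differentiable[OF \<xi>0] Dg_differentiable[OF \<xi>0] differentiable_imp_continuous_within by blast+
  have "((\<lambda>\<xi>. \<rho> (xs \<xi>, \<xi>) / \<omega>) \<longlongrightarrow> (norm (Df ?p - Df ?p)
      + (\<Sum>i\<in>UNIV. \<zeta> i * norm (Dg i ?p - Dg i ?p))) / \<omega>) (at \<xi>0 within \<Xi>)"
    unfolding \<rho>_def using \<omega>_pos
    by (intro tendsto_intros isCont_tendsto_compose[OF Df graph_tendsto[OF \<xi>0]]
        isCont_tendsto_compose[OF Dg graph_tendsto[OF \<xi>0]]) auto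
  then have lim: "((\<lambda>\<xi>. \<rho> (xs \<xi>, \<xi>) / \<omega>) \<longlongrightarrow> 0) (at \<xi>0 within \<Xi>)" by simp
  have "\<forall>\<^sub>F \<xi> in at \<xi>0 within \<Xi>. \<xi> \<in> \<Xi>" by (simp add: eventually_at_filter)
  with eventually_active_subset[OF \<xi>0]
  have "\<forall>\<^sub>F \<xi> in at \<xi>0 within \<Xi>. norm (ms \<xi> - ms \<xi>0) \<le> \<rho> (xs \<xi>, \<xi>) / \<omega>"
    by eventually_elim (use bound \<omega>_pos in \<open>simp add: field_simps\<close>)
  then have "((\<lambda>\<xi>. ms \<xi> - ms \<xi>0) \<longlongrightarrow> 0) (at \<xi>0 within \<Xi>)"
    using lim by (rule Lim_null_comparison)
  then show ?thesis by (simp add: Lim_null[symmetric])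
qed

section \<open>Lipschitz continuity of the solution maps\<close>

text \<open>At KKT multipliers, a Lipschitz constant in \<open>x\<close> of the gradient of the Lagrangian.\<close>

abbreviation B :: real where "B \<equiv> \<beta> + (\<Sum>i\<in>UNIV. \<zeta> i * l i)"

lemma kkt_grad_L_lipschitz:
  assumes "\<xi> \<in> \<Xi>" "kkt_point f g \<xi> x \<mu>"
  shows "norm (grad_L \<mu> (y', \<xi>) - grad_L \<mu> (y, \<xi>)) \<le> B * norm (y' - y)"
  using assms(2) multiplier_bound[OF assms] by (intro grad_L_lipschitz assms(1)) (auto simp: kkt_point_def)

lemma \<alpha>_le_B:
  assumes \<xi>: "\<xi> \<in> \<Xi>"
  shows "\<alpha> \<le> B"
proof -
  note k = mu_star_kkt[OF \<xi>]
  define e :: "real ^ 'n" where "e = axis undefined 1"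
  have "\<alpha> * (norm (e - 0))\<^sup>2 \<le> (e - 0) \<bullet> (grad_L (ms \<xi>) (e, \<xi>) - grad_L (ms \<xi>) (0, \<xi>))"
    using k by (intro grad_L_monotone \<xi>) (simp add: kkt_point_def)
  also have "\<dots> \<le> norm (e - 0) * norm (grad_L (ms \<xi>) (e, \<xi>) - grad_L (ms \<xi>) (0, \<xi>))"
    by (rule norm_cauchy_schwarz)
  also have "\<dots> \<le> norm (e - 0) * (B * norm (e - 0))"
    by (intro mult_left_mono kkt_grad_L_lipschitz[OF \<xi> k]) auto
  finally show ?thesis by (simp add: e_def)
qed

lemma B_pos: "\<xi> \<in> \<Xi> \<Longrightarrow> 0 < B"
  using \<alpha>_le_B \<alpha>_pos by fastforce

text \<open>The Hessian of the Lagrangian satisfies the hypotheses of \<open>saddle_point_estimate\<close>.\<close>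

lemma hessian_properties:
  assumes \<xi>: "\<xi> \<in> \<Xi>" and k: "kkt_point f g \<xi> x \<mu>"
    and D: "(grad_L \<mu> has_derivative D) (at (x, \<xi>))"
  shows "linear (\<lambda>v. D (v, 0))" and "u \<bullet> D (v, 0) = v \<bullet> D (u, 0)"
    and "\<alpha> * (norm v)\<^sup>2 \<le> v \<bullet> D (v, 0)" and "v \<bullet> D (v, 0) \<le> B * (norm v)\<^sup>2"
proof -
  have \<mu>: "0 \<le> \<mu>" using k by (simp add: kkt_point_def)
  have "((\<lambda>y. (y, \<xi>)) has_derivative (\<lambda>v. (v, 0))) (at x)" by (auto intro!: derivative_eq_intros)
  then have H: "((\<lambda>y. grad_L \<mu> (y, \<xi>)) has_derivative (\<lambda>v. D (v, 0))) (at x)"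
    using D by (rule has_derivative_compose)
  show "linear (\<lambda>v. D (v, 0))" using H by (rule has_derivative_linear)
  show "u \<bullet> D (v, 0) = v \<bullet> D (u, 0)"
    by (rule hessian_symmetric[OF lagrangian_gderiv[OF \<xi>] H])
  show "\<alpha> * (norm v)\<^sup>2 \<le> v \<bullet> D (v, 0)"
    by (rule derivative_monotone[OF H grad_L_monotone[OF \<xi> \<mu>]])
  have "norm (D (v, 0)) \<le> B * norm v"
    by (rule derivative_norm_le[OF H kkt_grad_L_lipschitz[OF \<xi> k]])
  then have "norm v * norm (D (v, 0)) \<le> norm v * (B * norm v)" by (intro mult_left_mono) auto
  then show "v \<bullet> D (v, 0) \<le> B * (norm v)\<^sup>2"
    using norm_cauchy_schwarz[of v "D (v, 0)"] by (simp add: power2_eq_square algebra_simps)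
qed

lemma L_star_eq:
  assumes \<xi>: "\<xi> \<in> \<Xi>" and D: "(grad_L (ms \<xi>) has_derivative D) (at (xs \<xi>, \<xi>))"
  shows "L_star f g \<xi> *v v = D (0, v)"
proof -
  let ?h = "\<lambda>\<eta>. gradient (\<lambda>x. lagrangian f g x (ms \<xi>) \<eta>) (xs \<xi>)"
  have z: "(xs \<xi>, \<xi>) \<in> UNIV \<times> \<Xi>" using \<xi> by simp
  have "\<forall>\<^sub>F w in nhds (xs \<xi>, \<xi>). \<forall>i. GDERIV (\<lambda>x. g (x, snd w) $ i) (fst w) :> Dg i w"
    by (intro eventually_all_finite C2_on_pgrad(2)[OF gi_C2 z])
  then have "\<forall>\<^sub>F w in nhds (xs \<xi>, \<xi>).
      GDERIV (\<lambda>x. lagrangian f g x (ms \<xi>) (snd w)) (fst w) :> grad_L (ms \<xi>) w"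
    using C2_on_pgrad(2)[OF f_C2 z]
  proof eventually_elim
    case (elim w)
    then show ?case using gderiv_lagrangian[of "snd w" "fst w"] by simp
  qed
  moreover have "filterlim (\<lambda>\<eta>. (xs \<xi>, \<eta>)) (nhds (xs \<xi>, \<xi>)) (nhds \<xi>)"
    by (intro tendsto_intros filterlim_ident)
  ultimately have ev: "\<forall>\<^sub>F \<eta> in nhds \<xi>. GDERIV (\<lambda>x. lagrangian f g x (ms \<xi>) \<eta>) (xs \<xi>) :> grad_L (ms \<xi>) (xs \<xi>, \<eta>)"
    by (auto simp: filterlim_iff)
  then have ev: "\<forall>\<^sub>F \<eta> in nhds \<xi>. grad_L (ms \<xi>) (xs \<xi>, \<eta>) = ?h \<eta>"
    by eventually_elim (simp add: gradient_eqI)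
  have "(?h has_derivative (\<lambda>v. D (0, v))) (at \<xi>)"
    using has_derivative_snd_slice[OF D]
    by (rule has_derivative_transform_eventually)
       (use ev in \<open>auto simp: eventually_nhds_conv_at\<close>)
  then show ?thesis unfolding L_star_def by (rule jacobian_eqI)
qed

lemma G_star_eq:
  assumes D: "(g has_derivative D) (at (xs \<xi>, \<xi>))"
  shows "(G_star f g \<xi> *v v) $ i = (if g (xs \<xi>, \<xi>) $ i = 0 then D (0, v) $ i else 0)"
proof -
  have "(G_star f g \<xi> *v v) $ i
      = (if i \<in> active_set g \<xi> (xs \<xi>) then (jacobian (\<lambda>\<eta>. g (xs \<xi>, \<eta>)) (at \<xi>) *v v) $ i else 0)"
    by (simp add: G_star_def rows_on_def matrix_vector_mul_component row_def vec_nth_inverse)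
  then show ?thesis by (simp add: jacobian_eqI[OF has_derivative_snd_slice[OF D]] active_set_def)
qed

lemma g_derivative_fst:
  assumes \<xi>: "\<xi> \<in> \<Xi>" and D: "(g has_derivative D) (at (x, \<xi>))"
  shows "D (v, 0) $ i = v \<bullet> Dg i (x, \<xi>)"
proof -
  have "((\<lambda>y. (y, \<xi>)) has_derivative (\<lambda>v. (v, 0))) (at x)" by (auto intro!: derivative_eq_intros)
  then have "((\<lambda>y. g (y, \<xi>)) has_derivative (\<lambda>v. D (v, 0))) (at x)"
    using D by (rule has_derivative_compose)
  then have "((\<lambda>y. g (y, \<xi>) $ i) has_derivative (\<lambda>v. D (v, 0) $ i)) (at x)"
    by (rule bounded_linear.has_derivative[OF bounded_linear_vec_nth])
  from has_derivative_unique[OF this g_gderiv[OF \<xi>, of i x, unfolded gderiv_def]]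
  show ?thesis by metis
qed

text \<open>The increments of the solutions solve, up to the residuals \<open>r1\<close>, \<open>r2\<close>, \<open>r3\<close> below, the
  linearised KKT system restricted to the constraints \<open>K\<close> active at both parameters. The residuals are at
  most a small multiple of the increments \<open>N\<close> themselves, so \<open>saddle_point_estimate\<close>
  followed by \<open>absorb_small_terms\<close> gives a bound as close as desired to the one for the exact system.\<close>

lemma solution_maps_local_estimate:
  assumes \<xi>0: "\<xi>0 \<in> \<Xi>" and \<epsilon>: "0 < \<epsilon>"
    and Lb: "\<And>v. norm (L_star f g \<xi>0 *v v) \<le> Lb * norm v" "0 \<le> Lb"
    and Gb: "\<And>v. norm (G_star f g \<xi>0 *v v) \<le> Gb * norm v" "0 \<le> Gb"
  defines "S \<equiv> Lb / \<alpha> + Gb / \<omega>"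
  shows "\<forall>\<^sub>F \<xi> in at \<xi>0 within \<Xi>.
    norm (xs \<xi> - xs \<xi>0) \<le> sqrt (B / \<alpha>) * ((S + \<epsilon>) * norm (\<xi> - \<xi>0)) \<and>
    norm (ms \<xi> - ms \<xi>0) \<le> B / \<omega> * ((S + \<epsilon>) * norm (\<xi> - \<xi>0))"
proof -
  note k0 = mu_star_kkt[OF \<xi>0] and \<alpha> = \<alpha>_pos[OF \<xi>0] and Bp = B_pos[OF \<xi>0]
  let ?p = "(xs \<xi>0, \<xi>0)"
  define I where "I = active_set g \<xi>0 (xs \<xi>0)"
  define \<Phi> where "\<Phi> = grad_L (ms \<xi>0)"
  have \<Phi>0: "\<Phi> ?p = 0" using k0 by (simp add: \<Phi>_def kkt_point_iff[OF \<xi>0])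
  obtain D where D: "(\<Phi> has_derivative D) (at ?p)"
    using grad_L_differentiable[OF \<xi>0] unfolding \<Phi>_def differentiable_def by blast
  obtain g' where g': "(g has_derivative g') (at ?p)"
    using g_C2 \<xi>0 unfolding C2_on_def by blast
  have D_split: "D (v, w) = D (v, 0) + D (0, w)" for v w
    using linear_add[OF has_derivative_linear[OF D], of "(v, 0)" "(0, w)"] by simp
  have g'_split: "g' (v, w) = g' (v, 0) + g' (0, w)" for v w
    using linear_add[OF has_derivative_linear[OF g'], of "(v, 0)" "(0, w)"] by simp
  note H = hessian_properties[OF \<xi>0 k0 D[unfolded \<Phi>_def]]
  have ind: "unif_indep \<omega> I (\<lambda>i. Dg i ?p)"
    unfolding I_def using k0 by (intro licq \<xi>0) (simp add: kkt_point_def)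

  \<comment> \<open>\<open>\<kappa>\<close> collects the factors of the residuals in the saddle point estimate, and \<open>c\<close> the factors
    by which that estimate bounds \<open>dx\<close> and \<open>d\<mu>\<close>; \<open>e\<close> is chosen so that \<open>\<kappa> * e\<close> is the \<open>\<eta>\<close> of
    \<open>absorb_small_terms\<close>.\<close>
  define m where "m = real (CARD('m))"
  define \<kappa> where "\<kappa> = (1 + m) / \<alpha> + 1 / \<omega>"
  define c where "c = sqrt (B / \<alpha>) + B / \<omega>"
  define \<eta> where "\<eta> = \<epsilon> / (1 + (S + \<epsilon>) * c)"
  define e where "e = \<eta> / \<kappa>"
  have \<kappa>: "0 < \<kappa>" using \<alpha> \<omega>_pos by (simp add: \<kappa>_def m_def add_pos_pos)
  have c: "0 \<le> c" using \<alpha> \<omega>_pos Bp by (simp add: c_def)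
  have S: "0 \<le> S" using \<alpha> \<omega>_pos Lb Gb by (simp add: S_def)
  have \<eta>: "0 < \<eta>" unfolding \<eta>_def using \<epsilon> c S by (intro divide_pos_pos add_pos_nonneg) auto
  then have e: "0 < e" using \<kappa> by (simp add: e_def)

  have near: "\<forall>\<^sub>F w in nhds ?p. norm (\<Phi> w - D (w - ?p)) \<le> e * norm (w - ?p) \<and>
      norm (g w - g ?p - g' (w - ?p)) \<le> e * norm (w - ?p) \<and> (\<forall>i. norm (Dg i w - Dg i ?p) \<le> e)"
  proof (intro eventually_conj eventually_all_finite)
    obtain d where "0 < d" "\<forall>w. norm (w - ?p) < d \<longrightarrow> norm (\<Phi> w - \<Phi> ?p - D (w - ?p)) \<le> e * norm (w - ?p)"
      using D e unfolding has_derivative_at_alt by blast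
    then show "\<forall>\<^sub>F w in nhds ?p. norm (\<Phi> w - D (w - ?p)) \<le> e * norm (w - ?p)"
      by (auto simp: eventually_nhds_metric dist_norm \<Phi>0)
    obtain d where "0 < d" "\<forall>w. norm (w - ?p) < d \<longrightarrow> norm (g w - g ?p - g' (w - ?p)) \<le> e * norm (w - ?p)"
      using g' e unfolding has_derivative_at_alt by blast
    then show "\<forall>\<^sub>F w in nhds ?p. norm (g w - g ?p - g' (w - ?p)) \<le> e * norm (w - ?p)"
      by (auto simp: eventually_nhds_metric dist_norm)
    have "isCont (Dg i) ?p" for i
      using Dg_differentiable[OF \<xi>0] differentiable_imp_continuous_within by blast
    then have lim: "(Dg i \<longlongrightarrow> Dg i ?p) (nhds ?p)" for i
      by (simp add: isCont_def tendsto_at_iff_tendsto_nhds)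
    show "\<forall>\<^sub>F w in nhds ?p. norm (Dg i w - Dg i ?p) \<le> e" for i
      by (rule eventually_mono[OF tendstoD[OF lim[of i] e]]) (simp add: dist_norm)
  qed
  have pos_mult: "\<forall>\<^sub>F \<xi> in at \<xi>0 within \<Xi>. \<forall>i. ms \<xi>0 $ i \<noteq> 0 \<longrightarrow> ms \<xi> $ i \<noteq> 0"
  proof (rule eventually_all_finite)
    fix i show "\<forall>\<^sub>F \<xi> in at \<xi>0 within \<Xi>. ms \<xi>0 $ i \<noteq> 0 \<longrightarrow> ms \<xi> $ i \<noteq> 0"
      using tendsto_imp_eventually_ne[OF tendsto_vec_nth[OF mu_star_tendsto[OF \<xi>0]], of i 0]
      by (cases "ms \<xi>0 $ i = 0") auto
  qed
  have "\<forall>\<^sub>F \<xi> in at \<xi>0 within \<Xi>. \<xi> \<in> \<Xi>" by (simp add: eventually_at_filter)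
  moreover have "\<forall>\<^sub>F \<xi> in at \<xi>0 within \<Xi>. norm (\<Phi> (xs \<xi>, \<xi>) - D ((xs \<xi>, \<xi>) - ?p)) \<le> e * norm ((xs \<xi>, \<xi>) - ?p) \<and>
      norm (g (xs \<xi>, \<xi>) - g ?p - g' ((xs \<xi>, \<xi>) - ?p)) \<le> e * norm ((xs \<xi>, \<xi>) - ?p) \<and>
      (\<forall>i. norm (Dg i (xs \<xi>, \<xi>) - Dg i ?p) \<le> e)"
    using graph_tendsto[OF \<xi>0] near unfolding filterlim_iff by blast
  ultimately show ?thesis
    using eventually_active_subset[OF \<xi>0] pos_mult
  proof eventually_elim
    case (elim \<xi>)
    note k = mu_star_kkt[OF elim(1)]
    define z where "z = (xs \<xi>, \<xi>)"
    define dx where "dx = xs \<xi> - xs \<xi>0"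
    define d\<mu> where "d\<mu> = ms \<xi> - ms \<xi>0"
    define d\<xi> where "d\<xi> = \<xi> - \<xi>0"
    define N where "N = norm dx + norm d\<xi> + norm d\<mu>"
    have z_diff: "z - ?p = (dx, d\<xi>)" by (simp add: z_def dx_def d\<xi>_def)
    have "norm (z - ?p) \<le> N" unfolding z_diff N_def using norm_Pair_le[of dx d\<xi>] norm_ge_zero[of d\<mu>] by linarith
    then have eN: "e * norm (z - ?p) \<le> e * N" using e by (intro mult_left_mono) auto
    define r1 where "r1 = \<Phi> z - D (z - ?p)"
    define r2 where "r2 = g z - g ?p - g' (z - ?p)"
    define r3 where "r3 = comb (\<lambda>i. Dg i z - Dg i ?p) d\<mu>"
    have r1: "norm r1 \<le> e * N" and r2: "norm r2 \<le> e * N"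
      using elim(2) eN unfolding r1_def r2_def z_def by linarith+
    have "norm (d\<mu> $ i *\<^sub>R (Dg i z - Dg i ?p)) \<le> norm d\<mu> * e" for i
      unfolding norm_scaleR real_norm_def using elim(2)
      by (intro mult_mono component_le_norm_cart) (auto simp: z_def)
    then have "norm r3 \<le> m * (norm d\<mu> * e)"
      unfolding r3_def m_def by (intro order_trans[OF sum_norm_le[where g = "\<lambda>_. norm d\<mu> * e"]]) auto
    also have "\<dots> \<le> m * (e * N)"
      using e by (intro mult_left_mono) (auto simp: N_def m_def mult.commute)
    finally have r3: "norm r3 \<le> m * (e * N)" .

    have "grad_L (ms \<xi>) z = 0" using k by (simp add: z_def kkt_point_iff[OF elim(1)])
    moreover have "\<Phi> z = grad_L (ms \<xi>) z - comb (\<lambda>i. Dg i z) d\<mu>"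
      by (simp add: \<Phi>_def grad_L_def d\<mu>_def scaleR_diff_left sum_subtractf)
    ultimately have \<Phi>z: "\<Phi> z = - comb (\<lambda>i. Dg i z) d\<mu>" by simp
    have "r1 = - comb (\<lambda>i. Dg i z) d\<mu> - D (dx, 0) - D (0, d\<xi>)"
      unfolding r1_def \<Phi>z z_diff by (subst D_split) simp
    then have eq1: "D (dx, 0) + comb (\<lambda>i. Dg i ?p) d\<mu> = - (L_star f g \<xi>0 *v d\<xi>) - r1 - r3"
      unfolding r3_def L_star_eq[OF \<xi>0 D[unfolded \<Phi>_def]]
      by (simp add: scaleR_diff_right sum_subtractf)

    define K where "K = {i. g z $ i = 0 \<and> g ?p $ i = 0}"
    define w where "w = (\<chi> i. if i \<in> K then Dg i ?p \<bullet> dx else 0)"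
    have indK: "unif_indep \<omega> K (\<lambda>i. Dg i ?p)"
      by (rule unif_indep_subset[OF ind]) (auto simp: K_def I_def active_set_def)
    \<comment> \<open>A constraint where the multipliers differ has a positive multiplier at one of the parameters.
      If it is positive at \<open>\<xi>0\<close>, continuity makes it positive at \<open>\<xi>\<close>; so it is active at \<open>\<xi>\<close>,
      and hence also at \<open>\<xi>0\<close>.\<close>
    have supp: "d\<mu> $ i = 0" if "i \<notin> K" for i
    proof (rule ccontr)
      assume "d\<mu> $ i \<noteq> 0"
      then have "ms \<xi> $ i \<noteq> 0" using elim(4) by (auto simp: d\<mu>_def)
      then have "g z $ i = 0" unfolding z_def by (rule active_multiplier[OF elim(1) k])
      then have "i \<in> K" using elim(3) by (auto simp: K_def active_set_def z_def)
      then show False using that by blast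
    qed
    \<comment> \<open>On \<open>K\<close> both values of the constraint vanish, so its linearisation is the residual \<open>r2\<close> alone.
      The components of \<open>G_star\<close> outside \<open>K\<close> are dropped, which does not increase the norm.\<close>
    have "\<bar>w $ i\<bar> \<le> \<bar>(G_star f g \<xi>0 *v d\<xi> + r2) $ i\<bar>" for i
    proof (cases "i \<in> K")
      case True
      have "r2 $ i = - g' (dx, 0) $ i - g' (0, d\<xi>) $ i"
        unfolding r2_def z_diff using True by (subst g'_split) (simp add: K_def)
      then show ?thesis
        using True G_star_eq[OF g', of d\<xi> i]
        by (simp add: w_def K_def g_derivative_fst[OF \<xi>0 g'] inner_commute)
    qed (simp add: w_def)
    then have "norm w \<le> norm (G_star f g \<xi>0 *v d\<xi> + r2)" by (intro norm_le_componentwise_cart) simp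
    then have nw: "norm w \<le> Gb * norm d\<xi> + e * N"
      using norm_triangle_ineq[of "G_star f g \<xi>0 *v d\<xi>" r2] Gb(1)[of d\<xi>] r2 by linarith

    define u where "u = - (L_star f g \<xi>0 *v d\<xi>) - r1 - r3"
    have "norm u \<le> norm (L_star f g \<xi>0 *v d\<xi>) + norm r1 + norm r3"
      unfolding u_def using norm_triangle_ineq4[of "- (L_star f g \<xi>0 *v d\<xi>) - r1" r3]
        norm_triangle_ineq4[of "- (L_star f g \<xi>0 *v d\<xi>)" r1] by simp
    then have nu: "norm u \<le> Lb * norm d\<xi> + (1 + m) * (e * N)"
      using Lb(1)[of d\<xi>] r1 r3 by (simp add: distrib_right)

    define X where "X = norm u / \<alpha> + norm w / \<omega>"
    have est: "norm dx \<le> sqrt (B / \<alpha>) * X" "norm d\<mu> \<le> B / \<omega> * X"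
      unfolding X_def
      by (rule saddle_point_estimate[OF H(1,2) \<alpha> H(3) Bp H(4) indK \<omega>_pos supp eq1[folded u_def]];
          simp add: w_def)+
    have "X \<le> (Lb * norm d\<xi> + (1 + m) * (e * N)) / \<alpha> + (Gb * norm d\<xi> + e * N) / \<omega>"
      unfolding X_def using nu nw \<alpha> \<omega>_pos by (intro add_mono divide_right_mono) auto
    also have "\<dots> = S * norm d\<xi> + \<kappa> * e * N"
      by (simp add: S_def \<kappa>_def add_divide_distrib algebra_simps)
    also have "\<kappa> * e = \<eta>" using \<kappa> by (simp add: e_def)
    finally have "X \<le> S * norm d\<xi> + \<eta> * N" .
    moreover have "\<eta> * N \<le> \<eta> * (norm d\<xi> + c * X)"
      using est \<eta> by (intro mult_left_mono) (auto simp: N_def c_def distrib_right)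
    ultimately have "X \<le> S * norm d\<xi> + \<eta> * (norm d\<xi> + c * X)" by linarith
    then have "X \<le> (S + \<epsilon>) * norm d\<xi>"
      by (rule absorb_small_terms[OF S \<epsilon> c \<eta>_def])
    then have "sqrt (B / \<alpha>) * X \<le> sqrt (B / \<alpha>) * ((S + \<epsilon>) * norm d\<xi>)"
      "B / \<omega> * X \<le> B / \<omega> * ((S + \<epsilon>) * norm d\<xi>)"
      using Bp \<alpha> \<omega>_pos by (simp_all only: mult_left_mono divide_nonneg_nonneg real_sqrt_ge_zero less_imp_le)
    then show ?case using est unfolding dx_def d\<mu>_def d\<xi>_def by linarith
  qed
qed

lemma solution_maps_lipschitz:
  assumes \<Xi>: "convex \<Xi>" "\<Xi> \<noteq> {}"
    and L: "bdd_above ((\<lambda>\<xi>. onorm ((*v) (L_star f g \<xi>))) ` \<Xi>)"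
    and G: "bdd_above ((\<lambda>\<xi>. onorm ((*v) (G_star f g \<xi>))) ` \<Xi>)"
  defines "S \<equiv> L_bar f g \<Xi> / \<alpha> + G_bar f g \<Xi> / \<omega>"
  shows "(sqrt (B / \<alpha>) * S)-lipschitz_on \<Xi> xs" and "(B / \<omega> * S)-lipschitz_on \<Xi> ms"
    and "0 \<le> S"
proof -
  obtain \<xi>1 where \<xi>1: "\<xi>1 \<in> \<Xi>" using \<Xi> by blast
  have \<alpha>: "0 < \<alpha>" and Bp: "0 < B" using \<alpha>_pos B_pos \<xi>1 by blast+
  have on: "norm (A *v v) \<le> onorm ((*v) A) * norm v" and on0: "0 \<le> onorm ((*v) A)"
    for A :: "real ^ 'r ^ 'k" and v
    by (intro onorm onorm_pos_le matrix_vector_mul_bounded_linear)+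
  have Lle: "onorm ((*v) (L_star f g \<xi>)) \<le> L_bar f g \<Xi>"
    and Gle: "onorm ((*v) (G_star f g \<xi>)) \<le> G_bar f g \<Xi>" if "\<xi> \<in> \<Xi>" for \<xi>
    unfolding L_bar_def G_bar_def using that L G by (auto intro: cSUP_upper)
  have Lb: "norm (L_star f g \<xi> *v v) \<le> L_bar f g \<Xi> * norm v"
    and Gb: "norm (G_star f g \<xi> *v v) \<le> G_bar f g \<Xi> * norm v" if "\<xi> \<in> \<Xi>" for \<xi> v
    using order_trans[OF on mult_right_mono[OF Lle[OF that]]]
      order_trans[OF on mult_right_mono[OF Gle[OF that]]] by simp_all
  have L0: "0 \<le> L_bar f g \<Xi>" and G0: "0 \<le> G_bar f g \<Xi>"
    using order_trans[OF on0 Lle[OF \<xi>1]] order_trans[OF on0 Gle[OF \<xi>1]] by simp_all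
  show S0: "0 \<le> S" unfolding S_def using L0 G0 \<alpha> \<omega>_pos by simp
  have step: "\<forall>\<^sub>F \<xi> in at \<xi>0 within \<Xi>. dist (h \<xi>) (h \<xi>0) \<le> C' * dist \<xi> \<xi>0"
    if c: "0 < c" and C': "c * S < C'"
      and loc: "\<And>\<epsilon>. 0 < \<epsilon> \<Longrightarrow> \<forall>\<^sub>F \<xi> in at \<xi>0 within \<Xi>. norm (h \<xi> - h \<xi>0) \<le> c * ((S + \<epsilon>) * norm (\<xi> - \<xi>0))"
    for c C' \<xi>0 and h :: "real ^ 'r \<Rightarrow> real ^ 'k"
  proof -
    have "0 < C' / c - S" using c C' by (simp add: field_simps)
    from loc[OF this] show ?thesis by eventually_elim (use c in \<open>simp add: dist_norm\<close>)
  qed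
  have loc: "\<forall>\<^sub>F \<xi> in at \<xi>0 within \<Xi>. norm (xs \<xi> - xs \<xi>0) \<le> sqrt (B / \<alpha>) * ((S + \<epsilon>) * norm (\<xi> - \<xi>0))"
    "\<forall>\<^sub>F \<xi> in at \<xi>0 within \<Xi>. norm (ms \<xi> - ms \<xi>0) \<le> B / \<omega> * ((S + \<epsilon>) * norm (\<xi> - \<xi>0))"
    if "\<xi>0 \<in> \<Xi>" "0 < \<epsilon>" for \<xi>0 \<epsilon>
    using solution_maps_local_estimate[OF that Lb[OF that(1)] L0 Gb[OF that(1)] G0]
    unfolding S_def eventually_conj_iff by blast+
  show "(sqrt (B / \<alpha>) * S)-lipschitz_on \<Xi> xs"
  proof (rule lipschitz_on_if_locally[OF \<Xi>(1)])
    show "\<forall>\<^sub>F \<xi> in at \<xi>0 within \<Xi>. dist (xs \<xi>) (xs \<xi>0) \<le> C' * dist \<xi> \<xi>0"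
      if "\<xi>0 \<in> \<Xi>" "sqrt (B / \<alpha>) * S < C'" for \<xi>0 C'
      by (rule step[OF _ that(2) loc(1)[OF that(1)]]) (use \<alpha> Bp in simp_all)
  qed (use S0 \<alpha> Bp in simp)
  show "(B / \<omega> * S)-lipschitz_on \<Xi> ms"
  proof (rule lipschitz_on_if_locally[OF \<Xi>(1)])
    show "\<forall>\<^sub>F \<xi> in at \<xi>0 within \<Xi>. dist (ms \<xi>) (ms \<xi>0) \<le> C' * dist \<xi> \<xi>0"
      if "\<xi>0 \<in> \<Xi>" "B / \<omega> * S < C'" for \<xi>0 C'
      by (rule step[OF _ that(2) loc(2)[OF that(1)]]) (use \<omega>_pos Bp in simp_all)
  qed (use S0 \<omega>_pos Bp in simp)
qed

end

theorem corollary7: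
  fixes \<Xi> :: "(real ^ 'r) set"
    and f :: "(real ^ 'n) \<times> (real ^ 'r) \<Rightarrow> real"
    and g :: "(real ^ 'n) \<times> (real ^ 'r) \<Rightarrow> real ^ 'm"
    and \<alpha> \<beta> \<omega> :: real
    and \<l> \<zeta> :: "'m \<Rightarrow> real"
  assumes "\<Xi> \<noteq> {}" and "convex \<Xi>"
    and "C2_on (UNIV \<times> \<Xi>) f" and "C2_on (UNIV \<times> \<Xi>) g"
    and "\<And>\<xi>. \<xi> \<in> \<Xi> \<Longrightarrow> feasible g \<xi> \<noteq> {}"
    and "\<And>\<xi>. \<xi> \<in> \<Xi> \<Longrightarrow> strongly_convex \<alpha> (\<lambda>x. f (x, \<xi>))"
    and "\<And>\<xi>. \<xi> \<in> \<Xi> \<Longrightarrow> \<beta>-lipschitz_on UNIV (gradient (\<lambda>x. f (x, \<xi>)))"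
    and "\<And>\<xi> i. \<xi> \<in> \<Xi> \<Longrightarrow> convex_on UNIV (\<lambda>x. g (x, \<xi>) $ i)"
    and "\<And>\<xi> i. \<xi> \<in> \<Xi> \<Longrightarrow> (\<l> i)-lipschitz_on UNIV (gradient (\<lambda>x. g (x, \<xi>) $ i))"
    and "0 < \<omega>"
    and "\<And>\<xi> x. \<xi> \<in> \<Xi> \<Longrightarrow> x \<in> feasible g \<xi> \<Longrightarrow> active_set g \<xi> x \<noteq> {} \<Longrightarrow>
           (let I = active_set g \<xi> x; J = rows_on I (jacobian (\<lambda>y. g (y, \<xi>)) (at x))
            in loewner_le (\<omega>\<^sup>2 *\<^sub>R mat_on I) (J ** transpose J))"
    and "\<And>i. 0 < \<zeta> i"
    and "\<And>\<xi> x \<mu> i. \<xi> \<in> \<Xi> \<Longrightarrow> kkt_point f g \<xi> x \<mu> \<Longrightarrow> \<mu> $ i \<le> \<zeta> i"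
    and "bdd_above ((\<lambda>\<xi>. onorm ((*v) (L_star f g \<xi>))) ` \<Xi>)"
    and "bdd_above ((\<lambda>\<xi>. onorm ((*v) (G_star f g \<xi>))) ` \<Xi>)"
  shows "(\<forall>\<xi>\<in>\<Xi>. \<exists>!x. x \<in> primal_solutions f g \<xi>) \<and>
    (\<forall>\<xi>\<in>\<Xi>. \<exists>!\<mu>. \<mu> \<in> dual_solutions f g \<xi>) \<and>
    (sqrt ((\<beta> + (\<Sum>i\<in>UNIV. \<zeta> i * \<l> i)) / \<alpha>)
        * (L_bar f g \<Xi> / \<alpha> + G_bar f g \<Xi> / \<omega>))-lipschitz_on \<Xi> (x_star f g) \<and>
    ((\<beta> + (\<Sum>i\<in>UNIV. \<zeta> i * \<l> i)) powr (3/2) / (\<alpha> powr (1/2) * \<omega>)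
        * (L_bar f g \<Xi> / \<alpha> + G_bar f g \<Xi> / \<omega>))-lipschitz_on \<Xi> (mu_star f g)"
proof -
  interpret parametric_program \<Xi> f g \<alpha> \<beta> \<omega> \<l> \<zeta>
    by unfold_locales (fact assms)+
  obtain \<xi> where \<xi>: "\<xi> \<in> \<Xi>" using assms(1) by blast
  note lip = solution_maps_lipschitz[OF assms(2,1,14,15)]
  show ?thesis
  proof (intro conjI ballI)
    show "(B powr (3/2) / (\<alpha> powr (1/2) * \<omega>) * (L_bar f g \<Xi> / \<alpha> + G_bar f g \<Xi> / \<omega>))-lipschitz_on \<Xi> ms"
      by (rule lipschitz_on_le[OF lip(2)]) (intro mult_right_mono lip(3)
        divide_le_powr_three_halves_divide \<alpha>_pos[OF \<xi>] \<alpha>_le_B[OF \<xi>] \<omega>_pos)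
  qed (use ex1_primal_solution ex1_dual_solution lip(1) in auto)
qed

end
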